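(* Let $M$ be a compact connected $C^{1}$ submanifold (without boundary) of $\mathbb{R}^{n}$ and let $X\in\mathcal{G}_{M}$. Then $X$ does not admit any Lipschitz continuous first integral $f\colon M\to\mathbb{R}$ that is definable in an o-minimal structure.
   Context: $\mathcal{X}_{M}$ is the space of $C^{1}$ vector fields on $M$, equipped with the $C^{1}$ topology. For $X\in\mathcal{X}_{M}$ let $\phi_{t}\colon M\to M$ be the one-parameter group of diffeomorphisms generated by $X$. A point $p\in M$ is nonwandering if for every neighborhood $U$ of $p$ there are arbitrarily large values of $t$ with $U\cap\phi_{t}(U)\neq\emptyset$; $\Omega$ denotes the set of nonwandering points. $\Gamma$ denotes the union of all singular points (zeros of $X$) and closed orbits (periodic orbits) of $X$. A singularity or closed orbit is called generic if it is hyperbolic. $\mathcal{G}_{M}$ is the set of all $X\in\mathcal{X}_{M}$ such that: (G1) $X$ has only a finite number of singularities, all generic; (G2) the closed orbits of $X$ are generic; (G3) the stable and unstable manifolds associated to the singularities and the closed orbits of $X$ are transversal; (G4) $\Omega=\overline{\Gamma}$. First integral: a first integral of a vector field $X$ on a compact connected manifold $M$ is a continuous function $f\colon M\to\mathbb{R}$ which is constant on the orbits of the flow generated by $X$ but is not constant on any nonempty open subset of $M$. O-minimal structure: an o-minimal structure on the ordered field $\mathbb{R}$ is a sequence $\mathcal{O}=\{\mathcal{O}_{m}\}_{m\ge 1}$, where $\mathcal{O}_{m}$ is a Boolean algebra of subsets of $\mathbb{R}^{m}$, such that for each $m\geq 1$: (i) $A\in\mathcal{O}_{m}$ implies $A\times\mathbb{R}\in\mathcal{O}_{m+1}$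 and $\mathbb{R}\times A\in\mathcal{O}_{m+1}$; (ii) $A\in\mathcal{O}_{m+1}$ implies $\Pi(A)\in\mathcal{O}_{m}$, where $\Pi\colon\mathbb{R}^{m+1}\to\mathbb{R}^{m}$ is the canonical projection; (iii) $\mathcal{O}_{m}$ contains all sets $\{x\in\mathbb{R}^{m}:p(x)=0\}$ with $p\colon\mathbb{R}^m\to\mathbb{R}$ polynomial; (iv) $\mathcal{O}_{1}$ consists exactly of the finite unions of intervals and points. A set $A\subset\mathbb{R}^{m}$ is definable in $\mathcal{O}$ if $A\in\mathcal{O}_{m}$; a function $g\colon S\to\mathbb{R}$, $S\subset\mathbb{R}^{m}$, is definable in $\mathcal{O}$ if its graph is a definable subset of $\mathbb{R}^{m}\times\mathbb{R}$. *)

theory Defs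
  imports "HOL-Analysis.Analysis"
begin

section \<open>\<open>C\<^sup>1\<close> submanifolds and vector fields\<close>

definition C1_on :: "('a::euclidean_space \<Rightarrow> 'b::euclidean_space) \<Rightarrow> 'a set \<Rightarrow> bool" where
  "C1_on f U \<longleftrightarrow>
     (\<exists>f'::'a \<Rightarrow> 'a \<Rightarrow>\<^sub>L 'b.
        (\<forall>x\<in>U. (f has_derivative blinfun_apply (f' x)) (at x)) \<and> continuous_on U f')"

definition C1_submanifold :: "'a::euclidean_space set \<Rightarrow> bool" where
  "C1_submanifold M \<longleftrightarrow>
     (\<exists>k. \<forall>p\<in>M. \<exists>U V S. \<exists>(h :: 'a \<Rightarrow> 'a) g.
        open U \<and> p \<in> U \<and> open V \<and> homeomorphism U V h g \<and> C1_on h U \<and> C1_on g V \<and>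
        subspace S \<and> dim S = k \<and> h ` (M \<inter> U) = S \<inter> V)"

text \<open>Velocities at \<open>p\<close> of \<open>C\<^sup>1\<close> curves lying in \<open>S\<close>; this is the usual tangent space
  when \<open>S\<close> is, near \<open>p\<close>, an embedded \<open>C\<^sup>1\<close> submanifold.\<close>

definition tangent_space :: "'a::euclidean_space set \<Rightarrow> 'a \<Rightarrow> 'a set" where
  "tangent_space S p =
     {v. \<exists>c e. 0 < e \<and> c ` {-e<..<e} \<subseteq> S \<and> c C1_differentiable_on {-e<..<e} \<and>
            c 0 = p \<and> (c has_vector_derivative v) (at (0::real))}"

text \<open>A vector field on \<open>M\<close> is represented by a function on the ambient space whose values
  off \<open>M\<close> are irrelevant.\<close>

definition C1_vector_field :: "'a::euclidean_space set \<Rightarrow> ('a \<Rightarrow> 'a) \<Rightarrow> bool" where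
  "C1_vector_field M X \<longleftrightarrow>
     (\<forall>p\<in>M. X p \<in> tangent_space M p) \<and>
     (\<forall>p\<in>M. \<exists>U F. open U \<and> p \<in> U \<and> C1_on F U \<and> (\<forall>x\<in>M \<inter> U. F x = X x))"

definition integral_curve ::
    "'a::euclidean_space set \<Rightarrow> ('a \<Rightarrow> 'a) \<Rightarrow> (real \<Rightarrow> 'a) \<Rightarrow> bool" where
  "integral_curve M X c \<longleftrightarrow>
     (\<forall>t. c t \<in> M \<and> (c has_vector_derivative X (c t)) (at t))"

text \<open>For a \<open>C\<^sup>1\<close> vector field on a compact submanifold there is exactly one complete integral
  curve through each \<open>p \<in> M\<close>; the value for \<open>p \<notin> M\<close> is meaningless.\<close>

definition flow :: "'a::euclidean_space set \<Rightarrow> ('a \<Rightarrow> 'a) \<Rightarrow> real \<Rightarrow> 'a \<Rightarrow> 'a" where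
  "flow M X t p = (THE c. integral_curve M X c \<and> c 0 = p) t"


section \<open>Singularities, closed orbits, nonwandering points\<close>

definition singularities :: "'a::euclidean_space set \<Rightarrow> ('a \<Rightarrow> 'a) \<Rightarrow> 'a set" where
  "singularities M X = {p\<in>M. X p = 0}"

definition closed_orbits :: "'a::euclidean_space set \<Rightarrow> ('a \<Rightarrow> 'a) \<Rightarrow> 'a set set" where
  "closed_orbits M X =
     {range (\<lambda>t. flow M X t p) | p. p \<in> M \<and> X p \<noteq> 0 \<and> (\<exists>T>0. flow M X T p = p)}"

definition critical_elements :: "'a::euclidean_space set \<Rightarrow> ('a \<Rightarrow> 'a) \<Rightarrow> 'a set set" where
  "critical_elements M X = (\<lambda>p. {p}) ` singularities M X \<union> closed_orbits M X"

definition nonwandering :: "'a::euclidean_space set \<Rightarrow> ('a \<Rightarrow> 'a) \<Rightarrow> 'a set" where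
  "nonwandering M X =
     {p\<in>M. \<forall>U. openin (top_of_set M) U \<and> p \<in> U \<longrightarrow>
        (\<forall>T. \<exists>t>T. U \<inter> flow M X t ` U \<noteq> {})}"


section \<open>Hyperbolicity\<close>

text \<open>\<open>z\<close> is an eigenvalue, with eigenvector \<open>u + iv\<close>, of the complexification of the
  restriction of \<open>A\<close> to the subspace \<open>T\<close>.\<close>

definition eigenvalue_on :: "'a::real_vector set \<Rightarrow> ('a \<Rightarrow> 'a) \<Rightarrow> complex \<Rightarrow> bool" where
  "eigenvalue_on T A z \<longleftrightarrow>
     (\<exists>u\<in>T. \<exists>v\<in>T. (u \<noteq> 0 \<or> v \<noteq> 0) \<and>
        A u = Re z *\<^sub>R u - Im z *\<^sub>R v \<and> A v = Im z *\<^sub>R u + Re z *\<^sub>R v)"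

text \<open>A derivative \<open>A\<close> within \<open>M\<close> is determined only on the tangent space, which it leaves
  invariant at a zero of \<open>X\<close>; only that restriction enters.\<close>

definition hyperbolic_singularity ::
    "'a::euclidean_space set \<Rightarrow> ('a \<Rightarrow> 'a) \<Rightarrow> 'a \<Rightarrow> bool" where
  "hyperbolic_singularity M X p \<longleftrightarrow>
     (\<exists>A. (X has_derivative A) (at p within M) \<and>
        (\<forall>z. eigenvalue_on (tangent_space M p) A z \<longrightarrow> Re z \<noteq> 0))"

text \<open>The hyperplane through \<open>p\<close> orthogonal to \<open>X p\<close> meets \<open>M\<close>, near \<open>p\<close>, in a transversal
  section of the flow.\<close>

definition cross_section :: "'a::euclidean_space set \<Rightarrow> ('a \<Rightarrow> 'a) \<Rightarrow> 'a \<Rightarrow> 'a set" where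
  "cross_section M X p = {y\<in>M. (y - p) \<bullet> X p = 0}"

definition minimal_period ::
    "'a::euclidean_space set \<Rightarrow> ('a \<Rightarrow> 'a) \<Rightarrow> 'a \<Rightarrow> real \<Rightarrow> bool" where
  "minimal_period M X p T \<longleftrightarrow>
     0 < T \<and> flow M X T p = p \<and> (\<forall>s. 0 < s \<and> s < T \<longrightarrow> flow M X s p \<noteq> p)"

text \<open>\<open>p\<close> is a hyperbolic fixed point of the Poincar\'e map \<open>y \<mapsto> \<phi>\<^bsub>\<tau> y\<^esub> y\<close>, where the return
  time \<open>\<tau>\<close> is the continuous function, unique near \<open>p\<close>, whose value at \<open>p\<close> is the period.\<close>

definition hyperbolic_closed_orbit ::
    "'a::euclidean_space set \<Rightarrow> ('a \<Rightarrow> 'a) \<Rightarrow> 'a set \<Rightarrow> bool" where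
  "hyperbolic_closed_orbit M X \<gamma> \<longleftrightarrow>
     (\<forall>p\<in>\<gamma>. let \<Sigma> = cross_section M X p in
        \<exists>T W \<tau> A. minimal_period M X p T \<and>
          open W \<and> p \<in> W \<and> continuous_on (\<Sigma> \<inter> W) \<tau> \<and> \<tau> p = T \<and>
          (\<forall>y\<in>\<Sigma> \<inter> W. flow M X (\<tau> y) y \<in> \<Sigma>) \<and>
          ((\<lambda>y. flow M X (\<tau> y) y) has_derivative A) (at p within \<Sigma>) \<and>
          (\<forall>z. eigenvalue_on (tangent_space \<Sigma> p) A z \<longrightarrow> cmod z \<noteq> 1))"


section \<open>Stable and unstable manifolds\<close>

text \<open>The unstable notions are the stable ones for the reversed flow \<open>\<lambda>t. \<phi> (- t)\<close>.\<close>

definition stable_manifold ::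
    "'a::euclidean_space set \<Rightarrow> (real \<Rightarrow> 'a \<Rightarrow> 'a) \<Rightarrow> 'a set \<Rightarrow> 'a set" where
  "stable_manifold M \<phi> \<sigma> = {x\<in>M. ((\<lambda>t. infdist (\<phi> t x) \<sigma>) \<longlongrightarrow> 0) at_top}"

definition unstable_manifold ::
    "'a::euclidean_space set \<Rightarrow> (real \<Rightarrow> 'a \<Rightarrow> 'a) \<Rightarrow> 'a set \<Rightarrow> 'a set" where
  "unstable_manifold M \<phi> \<sigma> = stable_manifold M (\<lambda>t. \<phi> (- t)) \<sigma>"

text \<open>A stable manifold is only injectively immersed and may accumulate on itself, so
  \<^const>\<open>tangent_space\<close> must not be applied to the whole set. For a small neighbourhood \<open>U\<close> of
  \<open>\<sigma>\<close> it is the increasing union over \<open>T\<close> of the embedded pieces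
  \<open>\<phi>\<^bsub>-T\<^esub>(W\<^sub>l\<^sub>o\<^sub>c)\<close>, with \<open>W\<^sub>l\<^sub>o\<^sub>c\<close> the points of the stable manifold whose forward orbit stays
  in \<open>U\<close>; its tangent space at \<open>x\<close> is that of these pieces.\<close>

definition stable_piece ::
    "'a::euclidean_space set \<Rightarrow> (real \<Rightarrow> 'a \<Rightarrow> 'a) \<Rightarrow> 'a set \<Rightarrow> 'a set \<Rightarrow> real \<Rightarrow> 'a set" where
  "stable_piece M \<phi> \<sigma> U T = {x \<in> stable_manifold M \<phi> \<sigma>. \<forall>t\<ge>T. \<phi> t x \<in> U}"

definition stable_tangent ::
    "'a::euclidean_space set \<Rightarrow> (real \<Rightarrow> 'a \<Rightarrow> 'a) \<Rightarrow> 'a set \<Rightarrow> 'a \<Rightarrow> 'a set" where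
  "stable_tangent M \<phi> \<sigma> x =
     {v. \<forall>U. open U \<and> \<sigma> \<subseteq> U \<longrightarrow> (\<exists>T. v \<in> tangent_space (stable_piece M \<phi> \<sigma> U T) x)}"

definition unstable_tangent ::
    "'a::euclidean_space set \<Rightarrow> (real \<Rightarrow> 'a \<Rightarrow> 'a) \<Rightarrow> 'a set \<Rightarrow> 'a \<Rightarrow> 'a set" where
  "unstable_tangent M \<phi> \<sigma> x = stable_tangent M (\<lambda>t. \<phi> (- t)) \<sigma> x"

definition transversal_manifolds ::
    "'a::euclidean_space set \<Rightarrow> (real \<Rightarrow> 'a \<Rightarrow> 'a) \<Rightarrow> 'a set \<Rightarrow> 'a set \<Rightarrow> bool" where
  "transversal_manifolds M \<phi> \<sigma> \<sigma>' \<longleftrightarrow>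
     (\<forall>x \<in> stable_manifold M \<phi> \<sigma> \<inter> unstable_manifold M \<phi> \<sigma>'.
        {a + b | a b. a \<in> stable_tangent M \<phi> \<sigma> x \<and> b \<in> unstable_tangent M \<phi> \<sigma>' x} =
        tangent_space M x)"


section \<open>The class \<open>\<G>\<^sub>M\<close>\<close>

definition generic_vector_fields :: "'a::euclidean_space set \<Rightarrow> ('a \<Rightarrow> 'a) set" where
  "generic_vector_fields M =
     {X. C1_vector_field M X \<and>
         finite (singularities M X) \<and>
         (\<forall>p \<in> singularities M X. hyperbolic_singularity M X p) \<and>
         (\<forall>\<gamma> \<in> closed_orbits M X. hyperbolic_closed_orbit M X \<gamma>) \<and>
         (\<forall>\<sigma> \<in> critical_elements M X. \<forall>\<sigma>' \<in> critical_elements M X.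
            transversal_manifolds M (flow M X) \<sigma> \<sigma>') \<and>
         nonwandering M X = closure (\<Union>(critical_elements M X))}"


section \<open>First integrals\<close>

definition first_integral ::
    "'a::euclidean_space set \<Rightarrow> ('a \<Rightarrow> 'a) \<Rightarrow> ('a \<Rightarrow> real) \<Rightarrow> bool" where
  "first_integral M X f \<longleftrightarrow>
     continuous_on M f \<and>
     (\<forall>p\<in>M. \<forall>t. f (flow M X t p) = f p) \<and>
     (\<forall>U. openin (top_of_set M) U \<and> U \<noteq> {} \<longrightarrow> \<not> f constant_on U)"


section \<open>O-minimal structures\<close>

text \<open>Since the dimension varies, points of \<open>\<real>\<^sup>m\<close> are represented here by lists of length
  \<open>m\<close>.\<close>

definition polynomial_fun :: "nat \<Rightarrow> (real list \<Rightarrow> real) \<Rightarrow> bool" where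
  "polynomial_fun m p \<longleftrightarrow>
     (\<exists>(E :: (nat \<Rightarrow> nat) set) c. finite E \<and>
        (\<forall>xs. length xs = m \<longrightarrow> p xs = (\<Sum>e\<in>E. c e * (\<Prod>i<m. xs ! i ^ e i))))"

definition o_minimal_structure :: "(nat \<Rightarrow> real list set set) \<Rightarrow> bool" where
  "o_minimal_structure \<O> \<longleftrightarrow>
     (\<forall>m\<ge>1.
        algebra {xs. length xs = m} (\<O> m) \<and>
        (\<forall>A \<in> \<O> m. {xs @ [r] | xs r. xs \<in> A} \<in> \<O> (Suc m) \<and>
                    {r # xs | xs r. xs \<in> A} \<in> \<O> (Suc m)) \<and>
        (\<forall>A \<in> \<O> (Suc m). butlast ` A \<in> \<O> m) \<and>
        (\<forall>p. polynomial_fun m p \<longrightarrow> {xs. length xs = m \<and> p xs = 0} \<in> \<O> m)) \<and>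
     \<O> 1 = {(\<lambda>r. [r]) ` \<Union>F | F. finite F \<and> (\<forall>I \<in> F. is_interval I)}"

text \<open>The coordinates of a vector, listed in the order of the index type.\<close>

definition coordinates :: "real ^ 'n::{finite,linorder} \<Rightarrow> real list" where
  "coordinates x = map (\<lambda>i. x $ i) (sorted_list_of_set UNIV)"

definition definable_fun ::
    "(nat \<Rightarrow> real list set set) \<Rightarrow> (real ^ 'n::{finite,linorder}) set \<Rightarrow>
     (real ^ 'n::{finite,linorder} \<Rightarrow> real) \<Rightarrow> bool" where
  "definable_fun \<O> S g \<longleftrightarrow> (\<lambda>x. coordinates x @ [g x]) ` S \<in> \<O> (Suc CARD('n))"

end

theory Submission
  imports Defs
begin

text \<open>
Suppose that \<open>f\<close> is a Lipschitz definable first integral. It is enough to show that \<open>f\<close> takes only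
finitely many values on the union \<open>\<Gamma>\<close> of singularities and closed orbits. Indeed, every orbit
accumulates at a nonwandering point, at which \<open>f\<close> has by continuity the value that it has on the
orbit (\<open>nonwandering_value\<close>). As the nonwandering set is the closure of \<open>\<Gamma>\<close>, all values of \<open>f\<close> then
lie in the finite set \<open>f(\<Gamma>)\<close>, and connectedness of \<open>M\<close> makes \<open>f\<close> constant, which a first integral is
not. The singularities are finite in number, so only the closed orbits matter.

Let \<open>p\<close> lie on a closed orbit \<open>\<gamma>\<close>. By continuity \<open>f\<close> has the value \<open>f p\<close> on the whole stable and on
the whole unstable manifold of \<open>\<gamma>\<close>. These two manifolds both contain \<open>p\<close>, and since each stable
manifold is transversal to each unstable one, their tangent spaces at \<open>p\<close> together span that of
\<open>M\<close>. Hence every vector tangent to \<open>M\<close> at \<open>p\<close> is a difference \<open>a - b\<close> of two directions along which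
\<open>M\<close> contains points with nearly the value \<open>f p\<close>. Such points \<open>p\<close> are called split critical
(\<open>closed_orbit_split_critical\<close>).

Being split critical is a first-order property, so the set of these points is definable, and so is
the set of their values. A Sard theorem holds for them (\<open>finite_split_critical_values\<close>). If the
values were infinite in number, they would contain an interval, and definable choice would give a
curve \<open>c \<mapsto> p c\<close> of split critical points with \<open>f (p c) = c\<close>. Over a smaller interval the curve
has right derivatives \<open>a c - b c\<close>, split into level directions with \<open>b\<close> continuous. For small \<open>t\<close>
the points \<open>p c + t a\<close> and \<open>p (c + t) + t b\<close> then differ by \<open>o(t)\<close>, while near them \<open>f\<close> takes values
\<open>o(t)\<close>-close to \<open>c\<close> and to \<open>c + t\<close>. This contradicts the Lipschitz condition.

The function \<open>flow\<close> is defined by unique choice of an integral curve, so existence and uniqueness of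
integral curves have to be proved (\<open>flow_properties\<close>): the field extends to a Lipschitz field on the
ambient space, Picard iteration solves the extended equation, and Nagumo's criterion keeps the
solution on \<open>M\<close>.
\<close>

section \<open>Polynomial functions of coordinate lists\<close>

lemma polynomial_fun_monomial: "polynomial_fun m (\<lambda>xs. c * (\<Prod>i<m. xs ! i ^ e i))"
  unfolding polynomial_fun_def by (rule exI[of _ "{e}"]) auto

lemma polynomial_fun_cong:
  assumes "polynomial_fun m p" "\<And>xs. length xs = m \<Longrightarrow> q xs = p xs"
  shows "polynomial_fun m q"
  using assms unfolding polynomial_fun_def by metis

lemma polynomial_fun_const: "polynomial_fun m (\<lambda>xs. c)"
  using polynomial_fun_monomial[of m c "\<lambda>_. 0"] by simp

lemma polynomial_fun_nth:
  assumes "i < m"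
  shows "polynomial_fun m (\<lambda>xs. xs ! i)"
proof -
  have "(\<Prod>j<m. xs ! j ^ (if j = i then 1 else 0)) = xs ! i" for xs :: "real list"
  proof -
    have "(\<Prod>j<m. xs ! j ^ (if j = i then 1 else 0)) = (\<Prod>j<m. if j = i then xs ! j else 1)"
      by (rule prod.cong) auto
    then show ?thesis using assms by simp
  qed
  then show ?thesis
    using polynomial_fun_monomial[of m 1 "\<lambda>j. if j = i then 1 else 0"] by simp
qed

lemma polynomial_fun_add:
  assumes "polynomial_fun m p" "polynomial_fun m q"
  shows "polynomial_fun m (\<lambda>xs. p xs + q xs)"
proof -
  obtain E c where E: "finite E" "\<And>xs. length xs = m \<Longrightarrow> p xs = (\<Sum>e\<in>E. c e * (\<Prod>i<m. xs ! i ^ e i))"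
    using assms(1) unfolding polynomial_fun_def by blast
  obtain E' c' where E': "finite E'" "\<And>xs. length xs = m \<Longrightarrow> q xs = (\<Sum>e\<in>E'. c' e * (\<Prod>i<m. xs ! i ^ e i))"
    using assms(2) unfolding polynomial_fun_def by blast
  define d where "d e = (if e \<in> E then c e else 0) + (if e \<in> E' then c' e else 0)" for e
  have "p xs + q xs = (\<Sum>e\<in>E \<union> E'. d e * (\<Prod>i<m. xs ! i ^ e i))" if "length xs = m" for xs
  proof -
    let ?M = "\<lambda>e. \<Prod>i<m. xs ! i ^ e i"
    have "(\<Sum>e\<in>E \<union> E'. d e * ?M e) =
      (\<Sum>e\<in>E \<union> E'. if e \<in> E then c e * ?M e else 0) + (\<Sum>e\<in>E \<union> E'. if e \<in> E' then c' e * ?M e else 0)"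
      unfolding sum.distrib[symmetric] by (rule sum.cong) (auto simp: d_def algebra_simps)
    also have "(\<Sum>e\<in>E \<union> E'. if e \<in> E then c e * ?M e else 0) = p xs"
      using E E' that by (simp add: sum.inter_restrict[symmetric] Int_absorb1 Int_commute)
    also have "(\<Sum>e\<in>E \<union> E'. if e \<in> E' then c' e * ?M e else 0) = q xs"
      using E E' that by (simp add: sum.inter_restrict[symmetric] Int_absorb1 Int_commute)
    finally show ?thesis by simp
  qed
  moreover have "finite (E \<union> E')" using E E' by simp
  ultimately show ?thesis unfolding polynomial_fun_def by blast
qed

lemma polynomial_fun_sum:
  assumes "finite I" "\<And>i. i \<in> I \<Longrightarrow> polynomial_fun m (p i)"
  shows "polynomial_fun m (\<lambda>xs. \<Sum>i\<in>I. p i xs)"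
  using assms
  by (induction I rule: finite_induct) (auto intro: polynomial_fun_const polynomial_fun_add)

lemma polynomial_fun_mult_monomial:
  assumes "polynomial_fun m p"
  shows "polynomial_fun m (\<lambda>xs. (a * (\<Prod>i<m. xs ! i ^ d i)) * p xs)"
proof -
  obtain E c where E: "finite E" "\<And>xs. length xs = m \<Longrightarrow> p xs = (\<Sum>e\<in>E. c e * (\<Prod>i<m. xs ! i ^ e i))"
    using assms(1) unfolding polynomial_fun_def by blast
  have "polynomial_fun m (\<lambda>xs. \<Sum>e\<in>E. (a * c e) * (\<Prod>i<m. xs ! i ^ (d i + e i)))"
    by (intro polynomial_fun_sum E polynomial_fun_monomial)
  then show ?thesis
    by (rule polynomial_fun_cong)
      (simp add: E sum_distrib_left power_add prod.distrib mult_ac)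
qed

lemma polynomial_fun_mult:
  assumes "polynomial_fun m p" "polynomial_fun m q"
  shows "polynomial_fun m (\<lambda>xs. p xs * q xs)"
proof -
  obtain E c where E: "finite E" "\<And>xs. length xs = m \<Longrightarrow> p xs = (\<Sum>e\<in>E. c e * (\<Prod>i<m. xs ! i ^ e i))"
    using assms(1) unfolding polynomial_fun_def by blast
  have "polynomial_fun m (\<lambda>xs. \<Sum>e\<in>E. (c e * (\<Prod>i<m. xs ! i ^ e i)) * q xs)"
    by (intro polynomial_fun_sum E polynomial_fun_mult_monomial assms)
  then show ?thesis
    by (rule polynomial_fun_cong) (simp add: E sum_distrib_right)
qed

section \<open>Coordinates in a Euclidean space\<close>

text \<open>The order in which the basis is listed does not matter, because definability is invariant under
linear substitutions.\<close>

definition basis_list :: "'a::euclidean_space list" where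
  "basis_list = (SOME bs. set bs = Basis \<and> distinct bs)"

lemma basis_list:
  "set basis_list = (Basis :: 'a::euclidean_space set)" "distinct (basis_list :: 'a list)"
  using someI_ex[OF finite_distinct_list[OF finite_Basis]] unfolding basis_list_def by auto

lemma length_basis_list [simp]: "length (basis_list :: 'a::euclidean_space list) = DIM('a)"
  using distinct_card[OF basis_list(2)] basis_list(1) by metis

lemma sum_basis_list:
  "(\<Sum>i<DIM('a). h (basis_list ! i :: 'a::euclidean_space)) = (\<Sum>b\<in>Basis. h b)"
proof -
  have "bij_betw (\<lambda>i. basis_list ! i :: 'a) {..<DIM('a)} Basis"
    using bij_betw_nth[of "basis_list :: 'a list" "{..<DIM('a)}" Basis] basis_list by auto
  then show ?thesis by (rule sum.reindex_bij_betw)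
qed

definition coords :: "'a::euclidean_space \<Rightarrow> real list" where
  "coords x = map (\<lambda>b. x \<bullet> b) basis_list"

definition vec_of :: "real list \<Rightarrow> 'a::euclidean_space" where
  "vec_of xs = (\<Sum>i<DIM('a). xs ! i *\<^sub>R basis_list ! i)"

lemma length_coords [simp]: "length (coords (x::'a::euclidean_space)) = DIM('a)"
  by (simp add: coords_def)

lemma vec_of_coords [simp]: "vec_of (coords x) = x"
proof -
  have "vec_of (coords x) = (\<Sum>i<DIM('a). (x \<bullet> basis_list ! i) *\<^sub>R (basis_list ! i :: 'a))"
    by (simp add: vec_of_def coords_def)
  also have "\<dots> = (\<Sum>b\<in>Basis. (x \<bullet> b) *\<^sub>R b)" by (rule sum_basis_list)
  finally show ?thesis by (simp add: euclidean_representation)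
qed

lemma coords_vec_of:
  assumes "length xs = DIM('a::euclidean_space)"
  shows "coords (vec_of xs :: 'a) = xs"
proof (rule nth_equalityI)
  show "length (coords (vec_of xs :: 'a)) = length xs" using assms by simp
  fix j assume "j < length (coords (vec_of xs :: 'a))"
  then have j: "j < DIM('a)" by simp
  have "basis_list ! i \<bullet> (basis_list ! j :: 'a) = (if i = j then 1 else 0)" if "i < DIM('a)" for i
    using that j basis_list(2)[where 'a='a] basis_list(1)[where 'a='a]
    by (metis inner_not_same_Basis inner_same_Basis length_basis_list nth_eq_iff_index_eq nth_mem)
  then have "(\<Sum>i<DIM('a). xs ! i * (basis_list ! i \<bullet> (basis_list ! j :: 'a))) =
      (\<Sum>i<DIM('a). if i = j then xs ! i else 0)"
    by (intro sum.cong) auto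
  also have "\<dots> = xs ! j" using j by simp
  finally show "coords (vec_of xs :: 'a) ! j = xs ! j"
    using j by (simp add: coords_def vec_of_def inner_sum_left)
qed

lemma coords_image: "coords ` A = {xs. length xs = DIM('a) \<and> vec_of xs \<in> (A :: 'a::euclidean_space set)}"
  by (force simp: coords_vec_of intro: coords_vec_of[symmetric])

lemma linear_vec_of:
  assumes "linear (T :: 'a::euclidean_space \<Rightarrow> 'b::real_vector)"
  shows "T (vec_of xs) = (\<Sum>i<DIM('a). xs ! i *\<^sub>R T (basis_list ! i))"
  using assms by (simp add: vec_of_def linear_sum linear_scale)

lemma polynomial_fun_vec_of:
  fixes q :: "'a::euclidean_space \<Rightarrow> real"
  assumes "real_polynomial_function q"
  shows "polynomial_fun DIM('a) (\<lambda>xs. q (vec_of xs))"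
  using assms
proof (induction q)
  case (linear f)
  have "f (vec_of xs) = (\<Sum>i<DIM('a). f (basis_list ! i) * xs ! i)" for xs
    using linear_vec_of[OF bounded_linear.linear[OF linear]] by (simp add: mult.commute)
  then show ?case
    by (auto intro!: polynomial_fun_sum polynomial_fun_mult polynomial_fun_const polynomial_fun_nth)
qed (auto intro: polynomial_fun_const polynomial_fun_add polynomial_fun_mult)

section \<open>Definable sets\<close>

text \<open>An o-minimal structure consists of sets of lists. Working with subsets of arbitrary Euclidean spaces
instead lets formulas quantify over points, vectors and tuples of these, so that definability of a
set is read off its definition by the rules collected in \<open>definable_intros\<close>.\<close>

locale o_minimal =
  fixes \<O> :: "nat \<Rightarrow> real list set set"
  assumes o_minimal: "o_minimal_structure \<O>"
begin

lemma algebra_structure: "m \<ge> 1 \<Longrightarrow> algebra {xs. length xs = m} (\<O> m)"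
  and cylinder_Cons: "m \<ge> 1 \<Longrightarrow> A \<in> \<O> m \<Longrightarrow> {r # xs | xs r. xs \<in> A} \<in> \<O> (Suc m)"
  and image_butlast: "m \<ge> 1 \<Longrightarrow> A \<in> \<O> (Suc m) \<Longrightarrow> butlast ` A \<in> \<O> m"
  and zero_set: "m \<ge> 1 \<Longrightarrow> polynomial_fun m p \<Longrightarrow> {xs. length xs = m \<and> p xs = 0} \<in> \<O> m"
  using o_minimal unfolding o_minimal_structure_def by auto

lemma length_member: "m \<ge> 1 \<Longrightarrow> A \<in> \<O> m \<Longrightarrow> xs \<in> A \<Longrightarrow> length xs = m"
  using algebra_structure[of m] by (force simp: algebra_iff_Un)

lemma structure_Int: "m \<ge> 1 \<Longrightarrow> A \<in> \<O> m \<Longrightarrow> B \<in> \<O> m \<Longrightarrow> A \<inter> B \<in> \<O> m"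
  using algebra_structure[of m] by (simp add: algebra_iff_Int)

lemma structure_Diff:
  assumes "m \<ge> 1" "A \<in> \<O> m" "B \<in> \<O> m"
  shows "A - B \<in> \<O> m"
proof -
  interpret algebra "{xs. length xs = m}" "\<O> m" by (rule algebra_structure[OF assms(1)])
  show ?thesis using Diff assms by simp
qed

lemma structure_top: "m \<ge> 1 \<Longrightarrow> {xs. length xs = m} \<in> \<O> m"
  by (rule algebra.top[OF algebra_structure])

lemma structure_INT:
  fixes k :: nat
  assumes "m \<ge> 1" "\<And>j. j < k \<Longrightarrow> {xs. length xs = m \<and> P j xs} \<in> \<O> m"
  shows "{xs. length xs = m \<and> (\<forall>j<k. P j xs)} \<in> \<O> m"
  using assms(2)
proof (induction k)
  case 0 then show ?case using structure_top[OF assms(1)] by simp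
next
  case (Suc k)
  have "{xs. length xs = m \<and> (\<forall>j<Suc k. P j xs)} =
     {xs. length xs = m \<and> (\<forall>j<k. P j xs)} \<inter> {xs. length xs = m \<and> P k xs}"
    by (auto simp: less_Suc_eq)
  then show ?case using Suc structure_Int[OF assms(1)] by simp
qed

lemma cylinder_append:
  assumes "k \<ge> 1" "S \<in> \<O> k"
  shows "{zs. length zs = m + k \<and> drop m zs \<in> S} \<in> \<O> (m + k)"
proof (induction m)
  case 0
  have "{zs. length zs = 0 + k \<and> drop 0 zs \<in> S} = S"
    using length_member[OF assms] by auto
  then show ?case using assms by simp
next
  case (Suc m)
  have "{zs. length zs = Suc m + k \<and> drop (Suc m) zs \<in> S}
      = {r # xs | xs r. xs \<in> {zs. length zs = m + k \<and> drop m zs \<in> S}}" (is "?A = ?B")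
  proof
    show "?A \<subseteq> ?B"
    proof
      fix zs assume "zs \<in> ?A"
      then show "zs \<in> ?B" by (cases zs) auto
    qed
  qed auto
  then show ?case using cylinder_Cons[OF _ Suc] assms by simp
qed

lemma image_take:
  assumes "m \<ge> 1" "A \<in> \<O> (m + k)"
  shows "take m ` A \<in> \<O> m"
  using assms(2)
proof (induction k arbitrary: A)
  case 0
  have "take m ` A = A" using length_member[of m A] assms(1) 0 by force
  then show ?case using 0 by simp
next
  case (Suc k)
  have "take m ` A = take m ` (butlast ` A)"
    using length_member[of "m + Suc k" A] assms(1) Suc.prems
    by (force simp: image_image butlast_conv_take)
  moreover have "butlast ` A \<in> \<O> (m + k)" using image_butlast[of "m + k" A] assms(1) Suc.prems by simp
  ultimately show ?case using Suc.IH by simp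
qed

text \<open>Preimages under linear maps come from projecting the intersection of a cylinder
  with the graph, which is a polynomial zero set.\<close>

lemma linear_substitution:
  assumes "m \<ge> 1" "k \<ge> 1" "S \<in> \<O> k"
  shows "{xs. length xs = m \<and> map (\<lambda>j. \<Sum>i<m. a j i * xs ! i) [0..<k] \<in> S} \<in> \<O> m"
proof -
  have "{zs. length zs = m + k \<and> (\<forall>j<k. (\<Sum>i<m. a j i * zs ! i) + (-1) * zs ! (m + j) = 0)} \<in> \<O> (m + k)"
    using assms(1)
    by (intro structure_INT zero_set polynomial_fun_add polynomial_fun_sum polynomial_fun_mult
        polynomial_fun_const polynomial_fun_nth) auto
  from structure_Int[OF _ cylinder_append[OF assms(2,3)] this] assms(1)
  have *: "{zs. length zs = m + k \<and> drop m zs \<in> S} \<inter>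
    {zs. length zs = m + k \<and> (\<forall>j<k. (\<Sum>i<m. a j i * zs ! i) + (-1) * zs ! (m + j) = 0)} \<in> \<O> (m + k)"
    (is "?Z \<in> _") by simp
  have drop: "drop m zs = map (\<lambda>j. \<Sum>i<m. a j i * take m zs ! i) [0..<k]" if "zs \<in> ?Z" for zs
  proof (rule nth_equalityI)
    have len: "length zs = m + k" using that by blast
    then show "length (drop m zs) = length (map (\<lambda>j. \<Sum>i<m. a j i * take m zs ! i) [0..<k])" by simp
    fix j assume "j < length (drop m zs)"
    then have j: "j < k" using len by simp
    then have "(\<Sum>i<m. a j i * zs ! i) + (-1) * zs ! (m + j) = 0" using that by blast
    then show "drop m zs ! j = map (\<lambda>j. \<Sum>i<m. a j i * take m zs ! i) [0..<k] ! j"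
      using j len by simp
  qed
  have "take m ` ?Z = {xs. length xs = m \<and> map (\<lambda>j. \<Sum>i<m. a j i * xs ! i) [0..<k] \<in> S}" (is "_ = ?R")
  proof
    show "take m ` ?Z \<subseteq> ?R"
    proof
      fix xs assume "xs \<in> take m ` ?Z"
      then obtain zs where zs: "zs \<in> ?Z" "xs = take m zs" by blast
      then have "length zs = m + k" "drop m zs \<in> S" by blast+
      then show "xs \<in> ?R" using drop[OF zs(1)] zs(2) by simp
    qed
    show "?R \<subseteq> take m ` ?Z"
    proof
      fix xs assume xs: "xs \<in> ?R"
      define ys where "ys = map (\<lambda>j. \<Sum>i<m. a j i * xs ! i) [0..<k]"
      have ys: "length xs = m" "length ys = k" "ys \<in> S" "\<And>j. j < k \<Longrightarrow> ys ! j = (\<Sum>i<m. a j i * xs ! i)"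
        using xs by (auto simp: ys_def)
      then have "xs @ ys \<in> ?Z" by (simp add: nth_append)
      moreover have "take m (xs @ ys) = xs" using ys(1) by simp
      ultimately show "xs \<in> take m ` ?Z" by (rule image_eqI[OF sym, rotated])
    qed
  qed
  then show ?thesis using image_take[OF assms(1) *] by simp
qed

definition definable :: "'a::euclidean_space set \<Rightarrow> bool" where
  "definable A \<longleftrightarrow> coords ` A \<in> \<O> DIM('a)"

lemma definable_iff:
  "definable (A :: 'a::euclidean_space set) \<longleftrightarrow> {xs. length xs = DIM('a) \<and> vec_of xs \<in> A} \<in> \<O> DIM('a)"
  by (simp add: definable_def coords_image)

lemma dim_ge: "DIM('a::euclidean_space) \<ge> 1"
  using DIM_positive[where 'a='a] by linarith

lemma definable_Int:
  assumes "definable (A :: 'a::euclidean_space set)" "definable B" shows "definable (A \<inter> B)"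
proof -
  have "{xs. length xs = DIM('a) \<and> vec_of xs \<in> A \<inter> B} =
    {xs. length xs = DIM('a) \<and> vec_of xs \<in> A} \<inter> {xs. length xs = DIM('a) \<and> vec_of xs \<in> B}" by auto
  then show ?thesis using structure_Int[OF dim_ge[where 'a='a]] assms unfolding definable_iff by simp
qed

lemma definable_Compl:
  assumes "definable (A :: 'a::euclidean_space set)" shows "definable (- A)"
proof -
  have "{xs. length xs = DIM('a) \<and> vec_of xs \<in> - A} =
    {xs. length xs = DIM('a)} - {xs. length xs = DIM('a) \<and> vec_of xs \<in> A}" by auto
  then show ?thesis using structure_Diff[OF dim_ge[where 'a='a] structure_top[OF dim_ge[where 'a='a]]] assms
    unfolding definable_iff by simp
qed

lemma definable_conj: "definable {z. P z} \<Longrightarrow> definable {z. Q z} \<Longrightarrow> definable {z. P z \<and> Q z}"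
  using definable_Int by (simp add: Collect_conj_eq)

lemma definable_not: "definable {z. P z} \<Longrightarrow> definable {z. \<not> P z}"
  using definable_Compl by (simp add: Collect_neg_eq)

lemma definable_disj: "definable {z. P z} \<Longrightarrow> definable {z. Q z} \<Longrightarrow> definable {z. P z \<or> Q z}"
  using definable_not[OF definable_conj[OF definable_not definable_not, of P Q]] by simp

lemma definable_imp: "definable {z. P z} \<Longrightarrow> definable {z. Q z} \<Longrightarrow> definable {z. P z \<longrightarrow> Q z}"
  unfolding imp_conv_disj by (intro definable_disj definable_not)

lemma definable_linear_vimage:
  fixes T :: "'a::euclidean_space \<Rightarrow> 'b::euclidean_space"
  assumes "linear T" "definable B"
  shows "definable (T -` B)"
proof -
  let ?c = "\<lambda>j i. T (basis_list ! i) \<bullet> basis_list ! j"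
  have "vec_of (map (\<lambda>j. \<Sum>i<DIM('a). ?c j i * xs ! i) [0..<DIM('b)]) = T (vec_of xs)" (is "vec_of ?l = _") for xs
  proof -
    have "?l = coords (T (vec_of xs))"
      by (rule nth_equalityI)
        (auto simp: coords_def linear_vec_of[OF assms(1)] inner_sum_left mult.commute)
    then show ?thesis by simp
  qed
  then have eq: "{xs. length xs = DIM('a) \<and> vec_of xs \<in> T -` B} =
     {xs. length xs = DIM('a) \<and> map (\<lambda>j. \<Sum>i<DIM('a). ?c j i * xs ! i) [0..<DIM('b)]
        \<in> {xs. length xs = DIM('b) \<and> vec_of xs \<in> B}}"
    by simp
  show ?thesis
    unfolding definable_iff eq
    by (rule linear_substitution[OF dim_ge[where 'a='a] dim_ge[where 'a='b]])
      (use assms(2) in \<open>simp add: definable_iff\<close>)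
qed

lemma definable_fst_image:
  fixes A :: "('a::euclidean_space \<times> 'b::euclidean_space) set"
  assumes "definable A"
  shows "definable (fst ` A)"
proof -
  let ?m = "DIM('a)" and ?k = "DIM('b)"
  \<comment> \<open>coordinates of the pair, read off the concatenated coordinates of its components\<close>
  let ?c = "\<lambda>j i. if i < ?m then fst (basis_list ! j :: 'a \<times> 'b) \<bullet> basis_list ! i
                   else snd (basis_list ! j :: 'a \<times> 'b) \<bullet> basis_list ! (i - ?m)"
  let ?l = "\<lambda>zs. map (\<lambda>j. \<Sum>i<?m + ?k. ?c j i * zs ! i) [0..<DIM('a \<times> 'b)]"
  have l: "?l zs = coords (vec_of (take ?m zs) :: 'a, vec_of (drop ?m zs) :: 'b)"
    if "length zs = ?m + ?k" for zs
  proof (rule nth_equalityI)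
    fix j assume "j < length (?l zs)"
    then have j: "j < DIM('a \<times> 'b)" by simp
    have "?l zs ! j = (\<Sum>i<?m + ?k. ?c j i * zs ! i)"
      using j by (simp cong: if_cong)
    also have "\<dots> = (\<Sum>i<?m. ?c j i * zs ! i) + (\<Sum>i<?k. ?c j (?m + i) * zs ! (?m + i))"
      by (induction ("?k :: nat")) (simp_all add: add.assoc)
    also have "\<dots> = (\<Sum>i<?m. (fst (basis_list ! j :: 'a \<times> 'b) \<bullet> basis_list ! i) * zs ! i)
        + (\<Sum>i<?k. (snd (basis_list ! j :: 'a \<times> 'b) \<bullet> basis_list ! i) * zs ! (?m + i))"
      by simp
    also have "\<dots> = (vec_of (take ?m zs) :: 'a, vec_of (drop ?m zs) :: 'b) \<bullet> basis_list ! j"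
      using that by (simp add: inner_prod_def vec_of_def inner_sum_left inner_sum_right inner_commute mult.commute)
    also have "\<dots> = coords (vec_of (take ?m zs) :: 'a, vec_of (drop ?m zs) :: 'b) ! j"
      using j by (simp add: coords_def)
    finally show "?l zs ! j = coords (vec_of (take ?m zs) :: 'a, vec_of (drop ?m zs) :: 'b) ! j" .
  qed simp
  have "{zs. length zs = ?m + ?k \<and> ?l zs \<in> coords ` A} \<in> \<O> (?m + ?k)" (is "?Z \<in> _")
    by (rule linear_substitution)
      (use assms dim_ge[where 'a='a] dim_ge[where 'a="'a \<times> 'b"] in \<open>simp_all add: definable_def\<close>)
  then have "take ?m ` ?Z \<in> \<O> ?m" using image_take[OF dim_ge[where 'a='a]] by blast
  moreover have "take ?m ` ?Z = coords ` (fst ` A)"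
  proof
    show "take ?m ` ?Z \<subseteq> coords ` (fst ` A)"
    proof
      fix xs assume "xs \<in> take ?m ` ?Z"
      then obtain zs where zs: "length zs = ?m + ?k" "?l zs \<in> coords ` A" "xs = take ?m zs" by auto
      then have "coords (vec_of (take ?m zs) :: 'a, vec_of (drop ?m zs) :: 'b) \<in> coords ` A" using l by simp
      then have "(vec_of (take ?m zs) :: 'a, vec_of (drop ?m zs) :: 'b) \<in> A"
        by (metis imageE vec_of_coords)
      moreover have "coords (vec_of xs :: 'a) = xs" using zs by (intro coords_vec_of) simp
      ultimately show "xs \<in> coords ` (fst ` A)" using zs(3) by (metis fst_conv image_eqI)
    qed
    show "coords ` (fst ` A) \<subseteq> take ?m ` ?Z"
    proof safe
      fix x :: 'a and y :: 'b assume "(x, y) \<in> A"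
      moreover have "?l (coords x @ coords y) = coords (x, y)"
        using l[of "coords x @ coords y"] by (simp del: DIM_prod)
      ultimately have "coords x @ coords y \<in> ?Z" by (simp del: DIM_prod)
      moreover have "take ?m (coords x @ coords y) = coords (fst (x, y))" by simp
      ultimately show "coords (fst (x, y)) \<in> take ?m ` ?Z" by (rule image_eqI[OF sym, rotated])
    qed
  qed
  ultimately show ?thesis by (simp add: definable_def)
qed

lemma definable_ex:
  fixes P :: "'a::euclidean_space \<Rightarrow> 'b::euclidean_space \<Rightarrow> bool"
  assumes "definable {w. P (fst w) (snd w)}"
  shows "definable {z. \<exists>y. P z y}"
proof -
  have "{z. \<exists>y. P z y} = fst ` {w. P (fst w) (snd w)}"
    by (auto simp: image_iff)
  then show ?thesis using definable_fst_image[OF assms] by simp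
qed

lemma definable_all:
  fixes P :: "'a::euclidean_space \<Rightarrow> 'b::euclidean_space \<Rightarrow> bool"
  assumes "definable {w. P (fst w) (snd w)}"
  shows "definable {z. \<forall>y. P z y}"
  using definable_not[OF definable_ex[of "\<lambda>z y. \<not> P z y", OF definable_not[OF assms]]] by simp

lemma definable_eq_0:
  fixes q :: "'a::euclidean_space \<Rightarrow> real"
  assumes "polynomial_function q"
  shows "definable {z. q z = 0}"
  using zero_set[OF dim_ge[where 'a='a] polynomial_fun_vec_of[of q]] assms
  by (simp add: definable_iff real_polynomial_function_eq)

end

lemma polynomial_function_fst:
  "polynomial_function F \<Longrightarrow> polynomial_function (\<lambda>z. fst (F z))"
  using polynomial_function_compose[OF _ polynomial_function_bounded_linear[OF bounded_linear_fst], of F]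
  by (simp add: o_def)

lemma polynomial_function_snd:
  "polynomial_function F \<Longrightarrow> polynomial_function (\<lambda>z. snd (F z))"
  using polynomial_function_compose[OF _ polynomial_function_bounded_linear[OF bounded_linear_snd], of F]
  by (simp add: o_def)

lemma polynomial_function_Pair:
  fixes F :: "'a::real_normed_vector \<Rightarrow> 'b::real_normed_vector"
    and G :: "'a \<Rightarrow> 'c::real_normed_vector"
  assumes "polynomial_function F" "polynomial_function G"
  shows "polynomial_function (\<lambda>z. (F z, G z))"
proof -
  have "bounded_linear (\<lambda>x :: 'b. (x, 0 :: 'c))" "bounded_linear (\<lambda>y :: 'c. (0 :: 'b, y))"
    by (intro bounded_linear_Pair bounded_linear_ident bounded_linear_zero)+
  then have "polynomial_function (\<lambda>z. (F z, 0 :: 'c))" "polynomial_function (\<lambda>z. (0 :: 'b, G z))"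
    using polynomial_function_compose[OF assms(1) polynomial_function_bounded_linear]
      polynomial_function_compose[OF assms(2) polynomial_function_bounded_linear]
    by (simp_all add: o_def)
  from polynomial_function_add[OF this] show ?thesis by simp
qed

lemma polynomial_function_times:
  fixes f g :: "'a::real_normed_vector \<Rightarrow> real"
  shows "polynomial_function f \<Longrightarrow> polynomial_function g \<Longrightarrow> polynomial_function (\<lambda>z. f z * g z)"
  using real_polynomial_function.intros(4) by (simp add: real_polynomial_function_eq[symmetric])

lemmas poly_intros = polynomial_function_id polynomial_function_const polynomial_function_fst
  polynomial_function_snd polynomial_function_Pair polynomial_function_add polynomial_function_diff
  polynomial_function_minus polynomial_function_mult polynomial_function_times

context o_minimal
begin

text \<open>Order is definable because the nonnegative reals are the squares.\<close>

lemma definable_le: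
  fixes f g :: "'a::euclidean_space \<Rightarrow> real"
  assumes "polynomial_function f" "polynomial_function g"
  shows "definable {z. f z \<le> g z}"
proof -
  have "(f z \<le> g z) = (\<exists>r. f z + r * r - g z = 0)" for z
  proof
    assume "f z \<le> g z"
    then have "f z + sqrt (g z - f z) * sqrt (g z - f z) - g z = 0" by simp
    then show "\<exists>r. f z + r * r - g z = 0" by blast
  next
    assume "\<exists>r. f z + r * r - g z = 0"
    then obtain r where "f z + r * r - g z = 0" by blast
    then show "f z \<le> g z" using zero_le_square[of r] by linarith
  qed
  moreover have "definable {z. \<exists>r. f z + r * r - g z = 0}"
    by (intro definable_ex definable_eq_0 poly_intros
        polynomial_function_compose[OF _ assms(1), unfolded o_def]
        polynomial_function_compose[OF _ assms(2), unfolded o_def])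
  ultimately show ?thesis by simp
qed

lemma definable_less:
  fixes f g :: "'a::euclidean_space \<Rightarrow> real"
  assumes "polynomial_function f" "polynomial_function g"
  shows "definable {z. f z < g z}"
  using definable_not[OF definable_le[OF assms(2,1)]] by (simp add: not_le)

lemma definable_eq:
  fixes f g :: "'a::euclidean_space \<Rightarrow> real"
  assumes "polynomial_function f" "polynomial_function g"
  shows "definable {z. f z = g z}"
  using definable_eq_0[OF polynomial_function_diff[OF assms]] by simp

lemma definable_norm_le:
  fixes F :: "'a::euclidean_space \<Rightarrow> 'b::euclidean_space"
  assumes "polynomial_function F" "polynomial_function r"
  shows "definable {z. norm (F z) \<le> r z}"
proof -
  have "(norm (F z) \<le> r z) = (0 \<le> r z \<and> (\<Sum>b\<in>Basis. (F z \<bullet> b) * (F z \<bullet> b)) \<le> r z * r z)" for z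
  proof -
    have "(\<Sum>b\<in>Basis. (F z \<bullet> b) * (F z \<bullet> b)) = (norm (F z))\<^sup>2"
      by (simp add: power2_norm_eq_inner euclidean_inner[of "F z" "F z"])
    then show ?thesis
      using power2_le_imp_le[of "norm (F z)" "r z"] power_mono[of "norm (F z)" "r z" 2] norm_ge_zero[of "F z"]
      by (auto simp: power2_eq_square intro: order_trans[OF norm_ge_zero])
  qed
  moreover have "definable {z. 0 \<le> r z \<and> (\<Sum>b\<in>Basis. (F z \<bullet> b) * (F z \<bullet> b)) \<le> r z * r z}"
    by (intro definable_conj definable_le poly_intros polynomial_function_sum polynomial_function_inner
        assms finite_Basis)
  ultimately show ?thesis by simp
qed

lemma definable_eq_vec:
  fixes F G :: "'a::euclidean_space \<Rightarrow> 'b::euclidean_space"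
  assumes "polynomial_function F" "polynomial_function G"
  shows "definable {z. F z = G z}"
  using definable_norm_le[OF polynomial_function_diff[OF assms] polynomial_function_const[of 0]] by simp

text \<open>A nonlinear polynomial substitution is expressed through its graph.\<close>

lemma definable_mem:
  fixes F :: "'a::euclidean_space \<Rightarrow> 'b::euclidean_space"
  assumes "definable B" "polynomial_function F"
  shows "definable {z. F z \<in> B}"
proof -
  have "definable {w :: 'a \<times> 'b. snd w \<in> B}"
    using definable_linear_vimage[OF bounded_linear.linear[OF bounded_linear_snd] assms(1)]
    by (simp add: vimage_def)
  then have "definable {z. \<exists>w. F z = w \<and> w \<in> B}"
    by (intro definable_ex definable_conj definable_eq_vec poly_intros
        polynomial_function_compose[OF _ assms(2), unfolded o_def])
  then show ?thesis by simp
qed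

lemmas definable_intros = definable_conj definable_disj definable_imp definable_not
  definable_ex definable_all definable_norm_le definable_le definable_less definable_eq definable_mem

section \<open>Definable subsets of the line\<close>

lemma definable_real_intervals:
  fixes A :: "real set"
  assumes "definable A"
  obtains F where "finite F" "\<forall>I\<in>F. is_interval I" "A = \<Union>F"
proof -
  have "length (basis_list :: real list) = Suc 0" by simp
  then obtain x where x: "basis_list = [x :: real]" by (auto simp only: length_Suc_conv length_0_conv)
  moreover have "set basis_list = {1 :: real}" using basis_list(1)[where 'a=real] by simp
  ultimately have "x = 1" by (metis list.set(1) list.set(2) singleton_inject)
  then have c: "coords = (\<lambda>r :: real. [r])" by (simp add: coords_def fun_eq_iff x)
  have "(\<lambda>r. [r]) ` A \<in> \<O> 1" using assms by (simp add: definable_def c)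
  then obtain F where F: "finite F" "\<forall>I\<in>F. is_interval I" "(\<lambda>r. [r]) ` A = (\<lambda>r. [r]) ` \<Union>F"
    using o_minimal unfolding o_minimal_structure_def by auto
  have "inj (\<lambda>r :: real. [r])" by (rule injI) simp
  then have "A = \<Union>F" using F(3) by (simp add: inj_image_eq_iff)
  then show ?thesis using F(1,2) by (intro that[of F]) auto
qed

lemma definable_infinite_imp_interval:
  fixes A :: "real set"
  assumes "definable A" "infinite A"
  obtains a b where "a < b" "{a<..<b} \<subseteq> A"
proof -
  obtain F where F: "finite F" "\<forall>I\<in>F. is_interval I" "A = \<Union>F"
    by (rule definable_real_intervals[OF assms(1)])
  then obtain I where I: "I \<in> F" "infinite I" using assms(2) by (meson finite_Union)
  then obtain x where "x \<in> I" by fastforce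
  moreover have "infinite (I - {x})" using I by simp
  then obtain y where "y \<in> I - {x}" by (metis ex_in_conv finite.emptyI)
  ultimately have xy: "min x y < max x y" "min x y \<in> I" "max x y \<in> I" by (auto simp: min_def max_def)
  then have "{min x y<..<max x y} \<subseteq> I"
    using F(2)[rule_format, OF I(1)] unfolding is_interval_1 by (meson greaterThanLessThan_iff less_imp_le subsetI)
  then show ?thesis using that[OF xy(1)] I(1) F(3) by blast
qed

text \<open>A definable set of reals without an interval is finite, and countably many finite sets cannot cover
an interval. This turns properties that hold for some member of a countable family of parameters
into properties that hold uniformly on an interval.\<close>

lemma definable_countable_cover:
  fixes D :: "'i \<Rightarrow> real set"
  assumes "a < b" "countable I" "{a<..<b} \<subseteq> (\<Union>i\<in>I. D i)" "\<And>i. i \<in> I \<Longrightarrow> definable (D i)"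
  obtains i a' b' where "i \<in> I" "a' < b'" "{a'<..<b'} \<subseteq> {a<..<b}" "{a'<..<b'} \<subseteq> D i"
proof -
  have def: "definable {z. z \<in> D i \<and> a < z \<and> z < b}" if "i \<in> I" for i
    by (intro definable_intros poly_intros assms(4) that)
  have "\<exists>i\<in>I. infinite {z. z \<in> D i \<and> a < z \<and> z < b}"
  proof (rule ccontr)
    assume "\<not> ?thesis"
    then have "countable (\<Union>i\<in>I. {z. z \<in> D i \<and> a < z \<and> z < b})"
      using assms(2) by (intro countable_UN) (auto intro: countable_finite)
    moreover have "{a<..<b} \<subseteq> (\<Union>i\<in>I. {z. z \<in> D i \<and> a < z \<and> z < b})" using assms(3) by (auto simp: subset_iff)
    ultimately have "countable {a<..<b}" using countable_subset by blast
    then show False using uncountable_open_interval[of a b] assms(1) by simp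
  qed
  then obtain i where i: "i \<in> I" "infinite {z. z \<in> D i \<and> a < z \<and> z < b}" by blast
  obtain a' b' where "a' < b'" "{a'<..<b'} \<subseteq> {z. z \<in> D i \<and> a < z \<and> z < b}"
    by (rule definable_infinite_imp_interval[OF def[OF i(1)] i(2)])
  then show ?thesis using i(1) by (intro that[of i a' b']) auto
qed

text \<open>A finite union of intervals has only finitely many end points.\<close>

lemma definable_right_germ:
  fixes A :: "real set"
  assumes "definable A"
  shows "eventually (\<lambda>y. y \<in> A) (at_right x) \<or> eventually (\<lambda>y. y \<notin> A) (at_right x)"
proof -
  have I: "eventually (\<lambda>y. y \<in> I) (at_right x) \<or> eventually (\<lambda>y. y \<notin> I) (at_right x)"
    if "is_interval I" for I :: "real set"
  proof (cases "eventually (\<lambda>y. y \<notin> I) (at_right x)")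
    case False
    then have near: "\<exists>z. x < z \<and> z < w \<and> z \<in> I" if "w > x" for w
      using that unfolding eventually_at_right_field by blast
    from near[of "x + 1"] obtain y where y: "x < y" "y \<in> I" by auto
    have "w \<in> I" if "x < w" "w < y" for w
      using near[OF that(1)] y that \<open>is_interval I\<close> unfolding is_interval_1 by (meson less_imp_le)
    then show ?thesis using y unfolding eventually_at_right_field by blast
  qed blast
  obtain F where F: "finite F" "\<forall>I\<in>F. is_interval I" "A = \<Union>F"
    by (rule definable_real_intervals[OF assms(1)])
  show ?thesis
  proof (cases "\<exists>J\<in>F. eventually (\<lambda>y. y \<in> J) (at_right x)")
    case True
    then show ?thesis using F(3) by (auto elim: eventually_mono)
  next
    case False
    then have "\<forall>J\<in>F. eventually (\<lambda>y. y \<notin> J) (at_right x)" using I F(2) by blast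
    then have "eventually (\<lambda>y. \<forall>J\<in>F. y \<notin> J) (at_right x)" using F(1) by (rule eventually_ball_finite[rotated])
    then show ?thesis using F(3) by (auto elim: eventually_mono)
  qed
qed

end

section \<open>Definable choice\<close>

text \<open>A canonical element of a nonempty bounded definable set of reals: its minimum, or else the
  midpoint of the longest open interval in the set that starts at its infimum. Both alternatives are
  first-order, so the choice is definable.\<close>

definition chosen :: "real set \<Rightarrow> real \<Rightarrow> bool" where
  "chosen A r \<longleftrightarrow> r \<in> A \<and>
     ((\<forall>s. s \<in> A \<longrightarrow> r \<le> s) \<or>
      (\<exists>l u. l < u \<and> (\<forall>s. s \<in> A \<longrightarrow> l < s) \<and> (\<forall>s. l < s \<and> s < u \<longrightarrow> s \<in> A) \<and>
             (\<forall>v. u < v \<longrightarrow> (\<exists>s. l < s \<and> s < v \<and> s \<notin> A)) \<and> 2 * r = l + u))"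

lemma chosen_unique:
  assumes "chosen A r" "chosen A r'"
  shows "r = r'"
proof -
  have min_mid: False
    if "r \<in> A" "\<forall>s. s \<in> A \<longrightarrow> r \<le> s" "l < u" "\<forall>s. s \<in> A \<longrightarrow> l < s" "\<forall>s. l < s \<and> s < u \<longrightarrow> s \<in> A" for r l u
  proof -
    have "l < r" using that by blast
    then have "(l + min r u) / 2 \<in> A" using that(3,5) by (auto simp: min_def)
    then show False using that(2) \<open>l < r\<close> \<open>l < u\<close> by (force simp: min_def split: if_splits)
  qed
  have mid_mid: "l \<ge> l'"
    if "l < u" "\<forall>s. l < s \<and> s < u \<longrightarrow> s \<in> A" "\<forall>s. s \<in> A \<longrightarrow> l' < s" for l u l'
  proof (rule ccontr)
    assume "\<not> l \<ge> l'"
    then have "(l + min u l') / 2 \<in> A" using that(1,2) by (auto simp: min_def)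
    then show False using that(3) \<open>\<not> l \<ge> l'\<close> by (force simp: min_def split: if_splits)
  qed
  have mid_end: "u \<ge> u'" if "\<forall>s. l < s \<and> s < u' \<longrightarrow> s \<in> A" "\<forall>v. u < v \<longrightarrow> (\<exists>s. l < s \<and> s < v \<and> s \<notin> A)" for l u u'
    using that by (meson not_le)
  let ?min = "\<lambda>r. \<forall>s. s \<in> A \<longrightarrow> r \<le> s"
  let ?mid = "\<lambda>r l u. l < u \<and> (\<forall>s. s \<in> A \<longrightarrow> l < s) \<and> (\<forall>s. l < s \<and> s < u \<longrightarrow> s \<in> A) \<and>
      (\<forall>v. u < v \<longrightarrow> (\<exists>s. l < s \<and> s < v \<and> s \<notin> A)) \<and> 2 * r = l + u"
  have A: "r \<in> A" "r' \<in> A" using assms by (simp_all add: chosen_def)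
  have "?min r \<or> (\<exists>l u. ?mid r l u)"
    by (rule assms(1)[unfolded chosen_def, THEN conjunct2])
  moreover have "?min r' \<or> (\<exists>l u. ?mid r' l u)"
    by (rule assms(2)[unfolded chosen_def, THEN conjunct2])
  moreover have "\<not> ?min p \<or> \<not> ?mid q l u" if "p \<in> A" for p q l u
    using min_mid[OF that, of l u] by blast
  ultimately consider "?min r" "?min r'" | l u l' u' where "?mid r l u" "?mid r' l' u'"
    using A by blast
  then show ?thesis
  proof cases
    case 1 then show ?thesis using A by force
  next
    case 2
    then have m: "l < u" "\<forall>s. s \<in> A \<longrightarrow> l < s" "\<forall>s. l < s \<and> s < u \<longrightarrow> s \<in> A"
      "\<forall>v. u < v \<longrightarrow> (\<exists>s. l < s \<and> s < v \<and> s \<notin> A)" "2 * r = l + u"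
      "l' < u'" "\<forall>s. s \<in> A \<longrightarrow> l' < s" "\<forall>s. l' < s \<and> s < u' \<longrightarrow> s \<in> A"
      "\<forall>v. u' < v \<longrightarrow> (\<exists>s. l' < s \<and> s < v \<and> s \<notin> A)" "2 * r' = l' + u'"
      by blast+
    have l: "l = l'" using mid_mid[OF m(1,3,7)] mid_mid[OF m(6,8,2)] by simp
    have "u \<le> u'" using mid_end[OF m(3), of u'] m(9) l by simp
    moreover have "u' \<le> u" using mid_end[OF m(8), of u] m(4) l by simp
    ultimately show ?thesis using m(5,10) l by simp
  qed
qed

context o_minimal
begin

text \<open>If the infimum is not attained, the right germ there must lie inside the set.\<close>

lemma chosen_exists:
  assumes "definable A" "bounded A" "A \<noteq> {}"
  shows "\<exists>r. chosen A r"
proof (cases "Inf A \<in> A")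
  case True
  moreover have "\<forall>s. s \<in> A \<longrightarrow> Inf A \<le> s"
    using cInf_lower[OF _ bounded_imp_bdd_below[OF assms(2)]] by blast
  ultimately show ?thesis unfolding chosen_def by blast
next
  case False
  let ?l = "Inf A"
  have bdd: "bdd_below A" "bdd_above A"
    using assms(2) by (auto intro: bounded_imp_bdd_below bounded_imp_bdd_above)
  have low: "?l < s" if "s \<in> A" for s
    using that False cInf_lower[OF that bdd(1)] by (metis order_le_less)
  have "\<not> eventually (\<lambda>y. y \<notin> A) (at_right ?l)"
  proof
    assume "eventually (\<lambda>y. y \<notin> A) (at_right ?l)"
    then obtain w where w: "w > ?l" "\<And>y. y > ?l \<Longrightarrow> y < w \<Longrightarrow> y \<notin> A"
      unfolding eventually_at_right_field by blast
    then obtain s where "s \<in> A" "s < w" using cInf_lessD[OF assms(3)] by blast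
    then show False using w(2) low by blast
  qed
  then obtain w where w: "w > ?l" "\<And>y. y > ?l \<Longrightarrow> y < w \<Longrightarrow> y \<in> A"
    using definable_right_germ[OF assms(1), of ?l] unfolding eventually_at_right_field by blast
  define U where "U = {u. ?l < u \<and> {?l<..<u} \<subseteq> A}"
  have wU: "w \<in> U" using w by (auto simp: U_def)
  obtain m where m: "\<And>s. s \<in> A \<Longrightarrow> s \<le> m" using bdd(2) by (auto simp: bdd_above_def)
  have "u \<le> m" if "u \<in> U" for u
  proof (rule ccontr)
    assume "\<not> u \<le> m"
    moreover have "?l < m" using m assms(3) low by (meson all_not_in_conv less_le_trans)
    ultimately have "(m + u) / 2 \<in> A" using that by (auto simp: U_def)
    then show False using m \<open>\<not> u \<le> m\<close> by force
  qed
  then have bU: "bdd_above U" by (auto simp: bdd_above_def)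
  let ?u = "Sup U"
  have "?l < ?u" using cSup_upper[OF wU bU] w(1) by linarith
  have sub: "s \<in> A" if s: "?l < s" "s < ?u" for s
  proof -
    obtain u where "u \<in> U" "s < u" using less_cSupD[OF _ s(2)] wU by blast
    then show ?thesis using s(1) by (auto simp: U_def)
  qed
  have "\<exists>s. ?l < s \<and> s < v \<and> s \<notin> A" if "?u < v" for v
  proof (rule ccontr)
    assume "\<not> ?thesis"
    then have "v \<in> U" using that \<open>?l < ?u\<close> by (auto simp: U_def)
    then show False using cSup_upper[OF _ bU] that by (meson not_le)
  qed
  moreover have "(?l + ?u) / 2 \<in> A" using sub \<open>?l < ?u\<close> by simp
  ultimately have "chosen A ((?l + ?u) / 2)"
    unfolding chosen_def using low sub \<open>?l < ?u\<close>
    by (intro conjI disjI2 exI[of _ ?l] exI[of _ ?u]) auto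
  then show ?thesis by blast
qed

text \<open>Choosing canonical coordinates in one direction cuts each fibre by a hyperplane orthogonal to \<open>b\<close>.\<close>

lemma definable_choice_coordinate:
  fixes S :: "('e::euclidean_space \<times> 'a::euclidean_space) set" and b :: 'a
  assumes "definable S" "\<And>c. bounded {y. (c, y) \<in> S}"
  shows "\<exists>S'\<subseteq>S. definable S' \<and> fst ` S' = fst ` S \<and>
           (\<forall>c x y. (c, x) \<in> S' \<longrightarrow> (c, y) \<in> S' \<longrightarrow> x \<bullet> b = y \<bullet> b)"
proof -
  define H where "H = {w :: 'e \<times> real. \<exists>y. (fst w, y) \<in> S \<and> y \<bullet> b = snd w}"
  have H: "definable H"
    unfolding H_def by (intro definable_intros poly_intros polynomial_function_inner assms)
  define A where "A c = {s. (c, s) \<in> H}" for c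
  have A: "A c = (\<lambda>y. y \<bullet> b) ` {y. (c, y) \<in> S}" for c
    by (auto simp: A_def H_def)
  have dA: "definable (A c)" for c
    unfolding A_def by (intro definable_intros poly_intros H)
  have bA: "bounded (A c)" for c
    unfolding A by (intro bounded_linear_image assms bounded_linear_inner_left)
  define S' where "S' = {w. w \<in> S \<and> chosen (A (fst w)) (snd w \<bullet> b)}"
  have "definable S'"
    unfolding S'_def chosen_def A_def mem_Collect_eq
    by (intro definable_intros poly_intros polynomial_function_inner H assms)
  moreover have "fst ` S' = fst ` S"
  proof
    show "fst ` S \<subseteq> fst ` S'"
    proof
      fix c assume "c \<in> fst ` S"
      then have "A c \<noteq> {}" by (force simp: A)
      then obtain r where r: "chosen (A c) r" using chosen_exists[OF dA bA] by blast
      then obtain y where "(c, y) \<in> S" "r = y \<bullet> b" by (auto simp: chosen_def A)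
      then have "(c, y) \<in> S'" using r by (simp add: S'_def)
      then show "c \<in> fst ` S'" by force
    qed
  qed (auto simp: S'_def)
  ultimately show ?thesis
    using chosen_unique by (intro exI[of _ S']) (auto simp: S'_def)
qed

text \<open>After a cut in each direction of the basis the fibres are single points.\<close>

lemma definable_choice:
  fixes S :: "('e::euclidean_space \<times> 'a::euclidean_space) set"
  assumes "definable S" "\<And>c. bounded {y. (c, y) \<in> S}"
  obtains g where "definable ((\<lambda>c. (c, g c)) ` fst ` S)" "\<And>c. c \<in> fst ` S \<Longrightarrow> (c, g c) \<in> S"
proof -
  have "\<exists>S'\<subseteq>S. definable S' \<and> fst ` S' = fst ` S \<and>
           (\<forall>c x y. (c, x) \<in> S' \<longrightarrow> (c, y) \<in> S' \<longrightarrow> (\<forall>b\<in>B. x \<bullet> b = y \<bullet> b))"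
    if "finite B" for B :: "'a set"
    using that
  proof induction
    case empty then show ?case using assms(1) by blast
  next
    case (insert b B)
    then obtain S1 where S1: "S1 \<subseteq> S" "definable S1" "fst ` S1 = fst ` S"
      "\<forall>c x y. (c, x) \<in> S1 \<longrightarrow> (c, y) \<in> S1 \<longrightarrow> (\<forall>b\<in>B. x \<bullet> b = y \<bullet> b)" by blast
    have "bounded {y. (c, y) \<in> S1}" for c
      by (rule bounded_subset[OF assms(2)[of c]]) (use S1(1) in auto)
    from definable_choice_coordinate[OF S1(2) this, of b] obtain S2 where S2:
      "S2 \<subseteq> S1" "definable S2" "fst ` S2 = fst ` S1"
      "\<forall>c x y. (c, x) \<in> S2 \<longrightarrow> (c, y) \<in> S2 \<longrightarrow> x \<bullet> b = y \<bullet> b" by blast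
    show ?case
    proof (intro exI[of _ S2] conjI allI impI ballI)
      show "S2 \<subseteq> S" "definable S2" "fst ` S2 = fst ` S" using S1 S2 by auto
      fix c x y b' assume *: "(c, x) \<in> S2" "(c, y) \<in> S2" "b' \<in> insert b B"
      show "x \<bullet> b' = y \<bullet> b'"
      proof (cases "b' = b")
        case True
        then show ?thesis using S2(4)[rule_format, OF *(1,2)] by simp
      next
        case False
        then have "b' \<in> B" using *(3) by simp
        moreover have "(c, x) \<in> S1" "(c, y) \<in> S1" using *(1,2) S2(1) by blast+
        ultimately show ?thesis using S1(4)[rule_format, of c x y b'] by simp
      qed
    qed
  qed
  from this[OF finite_Basis] obtain S' where S': "S' \<subseteq> S" "definable S'" "fst ` S' = fst ` S"
    "\<forall>c x y. (c, x) \<in> S' \<longrightarrow> (c, y) \<in> S' \<longrightarrow> (\<forall>b\<in>Basis. x \<bullet> b = y \<bullet> b)" by blast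
  have uniq: "x = y" if "(c, x) \<in> S'" "(c, y) \<in> S'" for c x y
    using S'(4) that euclidean_eqI by blast
  define g where "g c = (SOME y. (c, y) \<in> S')" for c
  have g: "(c, g c) \<in> S'" if c: "c \<in> fst ` S" for c
  proof -
    obtain y where "(c, y) \<in> S'" using c S'(3) by (metis imageE prod.collapse)
    then show ?thesis unfolding g_def by (rule someI)
  qed
  have "(\<lambda>c. (c, g c)) ` fst ` S = S'"
  proof
    show "S' \<subseteq> (\<lambda>c. (c, g c)) ` fst ` S"
    proof
      fix w assume w: "w \<in> S'"
      then have c: "fst w \<in> fst ` S" using S'(1) by blast
      have "snd w = g (fst w)" using uniq[of "fst w" "snd w"] g[OF c] w by simp
      then have "w = (fst w, g (fst w))" by (metis prod.collapse)
      then show "w \<in> (\<lambda>c. (c, g c)) ` fst ` S" using c by (metis image_eqI)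
    qed
  qed (use g in auto)
  then show ?thesis using that[of g] g S' by auto
qed

end

section \<open>Tameness of definable functions of one variable\<close>

text \<open>Past the last point up to which the inequality propagates, the local hypothesis would propagate it
further.\<close>

lemma right_increments_bound:
  fixes g :: "real \<Rightarrow> real"
  assumes "continuous_on {x..y} g" "x \<le> y"
    and loc: "\<And>c. x \<le> c \<Longrightarrow> c < y \<Longrightarrow> eventually (\<lambda>h. g (c + h) \<le> g c + K * h) (at_right 0)"
  shows "g y \<le> g x + K * (y - x)"
proof -
  let ?\<phi> = "\<lambda>t. g t - K * t"
  define S where "S = {t \<in> {x..y}. ?\<phi> t \<le> ?\<phi> x}"
  have "continuous_on {x..y} ?\<phi>" by (intro continuous_intros assms)
  then have "closed ({x..y} \<inter> ?\<phi> -` {..?\<phi> x})" by (rule continuous_closed_preimage) auto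
  moreover have "{x..y} \<inter> ?\<phi> -` {..?\<phi> x} = S" by (auto simp: S_def)
  ultimately have "closed S" by simp
  moreover have "S \<noteq> {}" "bounded S"
    using assms(2) by (auto simp: S_def intro: bounded_subset[OF bounded_closed_interval[of x y]])
  ultimately have m: "Sup S \<in> S" "\<And>t. t \<in> S \<Longrightarrow> t \<le> Sup S"
    by (auto intro!: closed_contains_Sup cSup_upper bounded_imp_bdd_above)
  let ?m = "Sup S"
  have "?m = y"
  proof (rule ccontr)
    assume "?m \<noteq> y"
    then have "?m < y" "x \<le> ?m" using m(1) by (auto simp: S_def)
    then have "eventually (\<lambda>h. g (?m + h) \<le> g ?m + K * h \<and> h < y - ?m) (at_right 0)"
      using loc[of ?m] eventually_at_right_real[of 0 "y - ?m"]
      by (auto intro: eventually_conj elim: eventually_mono)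
    then obtain h where h: "h > 0" "g (?m + h) \<le> g ?m + K * h" "h < y - ?m"
      unfolding eventually_at_right_field by (metis dense)
    then have "?m + h \<in> S" using m(1) by (auto simp: S_def algebra_simps)
    then show False using m(2)[of "?m + h"] h(1) by simp
  qed
  then show ?thesis using m(1) by (simp add: S_def algebra_simps)
qed

text \<open>This reduces statements about vector-valued functions to their coordinates: intervals are shrunk for
one coordinate after another.\<close>

lemma common_subinterval:
  fixes a b :: real and B :: "'b set"
  assumes "finite B" "a < b"
    and ex: "\<And>i a' b'. i \<in> B \<Longrightarrow> a' < b' \<Longrightarrow> {a'<..<b'} \<subseteq> {a<..<b} \<Longrightarrow>
           \<exists>c d. c < d \<and> {c<..<d} \<subseteq> {a'<..<b'} \<and> Q i {c<..<d}"
    and mono: "\<And>i I J. i \<in> B \<Longrightarrow> Q i I \<Longrightarrow> J \<subseteq> I \<Longrightarrow> Q i J"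
  shows "\<exists>c d. c < d \<and> {c<..<d} \<subseteq> {a<..<b} \<and> (\<forall>i\<in>B. Q i {c<..<d})"
proof -
  have "\<exists>c d. c < d \<and> {c<..<d} \<subseteq> {a<..<b} \<and> (\<forall>i\<in>B'. Q i {c<..<d})" if "B' \<subseteq> B" for B'
    using finite_subset[OF that assms(1)] that
  proof (induction B' rule: finite_induct)
    case empty
    then show ?case using assms(2) by blast
  next
    case (insert i B')
    then obtain c d where cd: "c < d" "{c<..<d} \<subseteq> {a<..<b}" "\<forall>i\<in>B'. Q i {c<..<d}" by auto
    obtain c' d' where cd': "c' < d'" "{c'<..<d'} \<subseteq> {c<..<d}" "Q i {c'<..<d'}"
      using ex[OF _ cd(1,2), of i] insert.prems by auto
    have "Q j {c'<..<d'}" if j: "j \<in> insert i B'" for j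
    proof (cases "j = i")
      case True then show ?thesis using cd'(3) by simp
    next
      case False
      then have "j \<in> B'" using j by simp
      then show ?thesis using mono[OF _ _ cd'(2)] cd(3) insert.prems by blast
    qed
    moreover have "{c'<..<d'} \<subseteq> {a<..<b}" using cd(2) cd'(2) by (rule subset_trans[rotated])
    ultimately show ?case using cd'(1) by (intro exI[of _ c'] exI[of _ d']) simp
  qed
  then show ?thesis by blast
qed

abbreviation graph_on :: "'a set \<Rightarrow> ('a \<Rightarrow> 'b) \<Rightarrow> ('a \<times> 'b) set" where
  "graph_on S g \<equiv> (\<lambda>c. (c, g c)) ` S"

context o_minimal
begin

lemma definable_interval: "definable {a<..<b::real}"
proof -
  have "definable {z. a < z \<and> z < b}" by (intro definable_intros poly_intros)
  moreover have "{z. a < z \<and> z < b} = {a<..<b}" by auto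
  ultimately show ?thesis by simp
qed

lemma definable_graph_on_subset:
  assumes "definable (graph_on I g)" "definable J" "J \<subseteq> I"
  shows "definable (graph_on J g)"
proof -
  have "graph_on J g = {w. w \<in> graph_on I g \<and> fst w \<in> J}" using assms(3) by auto
  moreover have "definable {w. w \<in> graph_on I g \<and> fst w \<in> J}"
    by (intro definable_intros poly_intros assms(1,2))
  ultimately show ?thesis by simp
qed

lemma definable_graph_on_inner:
  fixes g :: "'e::euclidean_space \<Rightarrow> 'a::euclidean_space"
  assumes "definable (graph_on I g)"
  shows "definable (graph_on I (\<lambda>c. g c \<bullet> b))"
proof -
  have "graph_on I (\<lambda>c. g c \<bullet> b) = {w. \<exists>y. (fst w, y) \<in> graph_on I g \<and> y \<bullet> b = snd w}" by force
  moreover have "definable {w. \<exists>y. (fst w, y) \<in> graph_on I g \<and> y \<bullet> b = snd w}"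
    by (intro definable_intros poly_intros polynomial_function_inner assms)
  ultimately show ?thesis by simp
qed

text \<open>Every interval of points of \<open>P\<close> lies in the interior of \<open>P\<close>, so the points of \<open>P\<close> outside the
  interior contain no interval. They form a definable set.\<close>

lemma finite_noninterior:
  fixes P :: "real set"
  assumes "definable P"
  defines "N \<equiv> {c. c \<in> P \<and> (\<forall>d. 0 < d \<longrightarrow> (\<exists>c'. norm (c' - c) \<le> d \<and> \<not> c' \<in> P))}"
  shows "definable N" "finite N"
proof -
  show N: "definable N"
    unfolding N_def by (intro definable_intros poly_intros assms(1))
  show "finite N"
  proof (rule ccontr)
    assume "infinite N"
    then obtain a b where ab: "a < b" "{a<..<b} \<subseteq> N"
      by (rule definable_infinite_imp_interval[OF N])
    define c where "c = (a + b) / 2"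
    define d where "d = (b - a) / 4"
    have "c \<in> N" using ab by (auto simp: c_def subset_iff)
    moreover have "d > 0" using ab(1) by (simp add: d_def)
    ultimately obtain c' where c': "norm (c' - c) \<le> d" "c' \<notin> P" unfolding N_def by blast
    then have "c' - c \<le> d" "c - c' \<le> d" by (auto simp: abs_le_iff)
    then have "a < c'" "c' < b" using ab(1) by (auto simp: c_def d_def field_simps)
    then show False using ab(2) c'(2) by (auto simp: N_def)
  qed
qed

text \<open>At a point of discontinuity some set \<open>{g < r}\<close> or \<open>{g > r}\<close> with rational \<open>r\<close> contains the point, but
no neighbourhood of it. Each of these countably many sets has finitely many such points.\<close>

lemma definable_continuous_scalar:
  fixes g :: "real \<Rightarrow> real"
  assumes "a < b" "definable (graph_on {a<..<b} g)"
  shows "\<exists>c d. c < d \<and> {c<..<d} \<subseteq> {a<..<b} \<and> continuous_on {c<..<d} g"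
proof -
  let ?G = "graph_on {a<..<b} g"
  \<comment> \<open>the points of continuity\<close>
  define C where "C = {c. \<exists>y. (c, y) \<in> ?G \<and> (\<forall>e. 0 < e \<longrightarrow> (\<exists>d. 0 < d \<and>
     (\<forall>c' y'. (c', y') \<in> ?G \<and> norm (c' - c) \<le> d \<longrightarrow> norm (y' - y) \<le> e)))}"
  have C: "definable C"
    unfolding C_def by (intro definable_intros poly_intros assms(2))
  define lo where "lo r = {c. \<exists>y. (c, y) \<in> ?G \<and> y < r}" for r
  define hi where "hi r = {c. \<exists>y. (c, y) \<in> ?G \<and> r < y}" for r
  have in_lo: "c \<in> lo r \<longleftrightarrow> c \<in> {a<..<b} \<and> g c < r"
    and in_hi: "c \<in> hi r \<longleftrightarrow> c \<in> {a<..<b} \<and> r < g c" for c r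
    unfolding lo_def hi_def by blast+
  have lh: "definable (lo r)" "definable (hi r)" for r
    unfolding lo_def hi_def by (intro definable_intros poly_intros assms(2))+
  define N where "N P = {c. c \<in> P \<and> (\<forall>d. 0 < d \<longrightarrow> (\<exists>c'. norm (c' - c) \<le> d \<and> \<not> c' \<in> P))}" for P :: "real set"
  define D where "D i = (case i of None \<Rightarrow> C | Some (up, r) \<Rightarrow> N (if up then hi r else lo r))"
    for i :: "(bool \<times> real) option"
  let ?I = "insert None (Some ` ((UNIV :: bool set) \<times> (\<rat> :: real set)))"
  have cover: "{a<..<b} \<subseteq> (\<Union>i\<in>?I. D i)"
  proof
    fix c assume c: "c \<in> {a<..<b}"
    show "c \<in> (\<Union>i\<in>?I. D i)"
    proof (cases "\<exists>r\<in>\<rat>. c \<in> N (hi r) \<or> c \<in> N (lo r)")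
      case True
      then obtain r where "r \<in> \<rat>" "c \<in> D (Some (True, r)) \<or> c \<in> D (Some (False, r))"
        by (auto simp: D_def)
      then show ?thesis by blast
    next
      case False
      have "\<exists>d. 0 < d \<and> (\<forall>c' y'. (c', y') \<in> ?G \<and> norm (c' - c) \<le> d \<longrightarrow> norm (y' - g c) \<le> e)"
        if e: "0 < e" for e
      proof -
        obtain r where r: "r \<in> \<rat>" "g c - e < r" "r < g c" using Rats_dense_in_real[of "g c - e" "g c"] e by auto
        obtain s where s: "s \<in> \<rat>" "g c < s" "s < g c + e" using Rats_dense_in_real[of "g c" "g c + e"] e by auto
        have "c \<in> hi r" "c \<in> lo s" using r s c by (simp_all add: in_hi in_lo)
        moreover have "c \<notin> N (hi r)" "c \<notin> N (lo s)" using False r s by auto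
        ultimately obtain d1 d2 where d: "d1 > 0" "\<And>c'. norm (c' - c) \<le> d1 \<Longrightarrow> c' \<in> hi r"
          "d2 > 0" "\<And>c'. norm (c' - c) \<le> d2 \<Longrightarrow> c' \<in> lo s"
          unfolding N_def by blast
        show ?thesis
        proof (intro exI[of _ "min d1 d2"] conjI allI impI)
          fix c' y' assume *: "(c', y') \<in> ?G \<and> norm (c' - c) \<le> min d1 d2"
          then have "c' \<in> hi r" "c' \<in> lo s" using d(2,4)[of c'] by auto
          moreover have "y' = g c'" using * by auto
          ultimately show "norm (y' - g c) \<le> e" using r s by (auto simp: in_hi in_lo)
        qed (use d in auto)
      qed
      moreover have "(c, g c) \<in> ?G" using c by blast
      ultimately have "c \<in> C" unfolding C_def by blast
      then show ?thesis by (auto simp: D_def)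
    qed
  qed
  have D: "definable (D i)" for i
    unfolding D_def N_def using C finite_noninterior(1)[OF lh(1)] finite_noninterior(1)[OF lh(2)]
    by (auto split: option.split)
  have bool: "countable (UNIV :: bool set)" by (rule countable_finite) simp
  have cnt: "countable ?I"
    by (intro countable_insert countable_image countable_SIGMA countable_rat bool)
  obtain i a' b' where i: "i \<in> ?I" "a' < b'" "{a'<..<b'} \<subseteq> {a<..<b}" "{a'<..<b'} \<subseteq> D i"
    by (rule definable_countable_cover[OF assms(1) cnt cover D])
  have "infinite (D i)" using i(2,4) finite_subset infinite_Ioo by metis
  moreover have "finite (D (Some (up, r)))" for up r
    unfolding D_def N_def using finite_noninterior(2)[OF lh(1)] finite_noninterior(2)[OF lh(2)] by auto
  ultimately have "i = None" by (metis option.exhaust prod.exhaust)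
  then have sub: "{a'<..<b'} \<subseteq> C" using i(4) by (simp add: D_def)
  have "continuous_on {a'<..<b'} g"
    unfolding continuous_on_iff
  proof (intro ballI allI impI)
    fix c e :: real assume c: "c \<in> {a'<..<b'}" and e: "0 < e"
    then have "c \<in> C" using sub by blast
    then obtain y where y: "(c, y) \<in> ?G" "\<forall>e. 0 < e \<longrightarrow> (\<exists>d. 0 < d \<and>
     (\<forall>c' y'. (c', y') \<in> ?G \<and> norm (c' - c) \<le> d \<longrightarrow> norm (y' - y) \<le> e))" unfolding C_def by blast
    then have "y = g c" by auto
    obtain d where d: "0 < d" "\<And>c' y'. (c', y') \<in> ?G \<Longrightarrow> norm (c' - c) \<le> d \<Longrightarrow> norm (y' - y) \<le> e/2"
      using y(2)[rule_format, of "e/2"] e by auto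
    show "\<exists>d>0. \<forall>x'\<in>{a'<..<b'}. dist x' c < d \<longrightarrow> dist (g x') (g c) < e"
    proof (intro exI[of _ d] conjI ballI impI)
      fix x' assume x': "x' \<in> {a'<..<b'}" "dist x' c < d"
      then have "x' \<in> {a<..<b}" using i(3) by blast
      then have "(x', g x') \<in> ?G" by blast
      from d(2)[OF this] x'(2) e show "dist (g x') (g c) < e" by (simp add: dist_norm \<open>y = g c\<close>)
    qed (fact d(1))
  qed
  then show ?thesis using i(2,3) by blast
qed

lemma definable_continuous:
  fixes g :: "real \<Rightarrow> 'a::euclidean_space"
  assumes "a < b" "definable (graph_on {a<..<b} g)"
  shows "\<exists>c d. c < d \<and> {c<..<d} \<subseteq> {a<..<b} \<and> continuous_on {c<..<d} g"
proof -
  have "\<exists>c d. c < d \<and> {c<..<d} \<subseteq> {a<..<b} \<and> (\<forall>i\<in>Basis. continuous_on {c<..<d} (\<lambda>c. g c \<bullet> i))"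
  proof (rule common_subinterval)
    fix i :: 'a and a' b' :: real assume "a' < b'" "{a'<..<b'} \<subseteq> {a<..<b}"
    then show "\<exists>c d. c < d \<and> {c<..<d} \<subseteq> {a'<..<b'} \<and> continuous_on {c<..<d} (\<lambda>c. g c \<bullet> i)"
      by (intro definable_continuous_scalar definable_graph_on_inner
          definable_graph_on_subset[OF assms(2) definable_interval])
  qed (use assms(1) in \<open>auto intro: continuous_on_subset\<close>)
  then show ?thesis using continuous_on_componentwise by blast
qed

text \<open>Each difference quotient is eventually on one side of any given bound, so one-sided
  derivatives exist in the extended reals. They cannot be infinite throughout an interval on which
  the function is continuous, since all its increments would then be infinite.\<close>

lemma definable_right_derivative_scalar:
  fixes g :: "real \<Rightarrow> real"
  assumes "a < b" "definable (graph_on {a<..<b} g)"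
  shows "\<exists>c d. c < d \<and> {c<..<d} \<subseteq> {a<..<b} \<and>
    (\<forall>x\<in>{c<..<d}. \<exists>l. ((\<lambda>h. (g (x + h) - g x) / h) \<longlongrightarrow> l) (at_right 0))"
proof -
  obtain a0 b0 where ab0: "a0 < b0" "{a0<..<b0} \<subseteq> {a<..<b}" and cont: "continuous_on {a0<..<b0} g"
    using definable_continuous_scalar[OF assms] by blast
  let ?G = "graph_on {a0<..<b0} g"
  have G: "definable ?G" by (rule definable_graph_on_subset[OF assms(2) definable_interval ab0(2)])
  \<comment> \<open>the points with right derivative \<open>\<infinity>\<close>, with \<open>-\<infinity>\<close>, and with a finite one\<close>
  define Up where "Up = {c. \<exists>y. (c, y) \<in> ?G \<and> (\<forall>K. \<exists>d. 0 < d \<and>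
     (\<forall>h y'. 0 < h \<and> h < d \<and> (c + h, y') \<in> ?G \<longrightarrow> y + K * h \<le> y'))}"
  define Dn where "Dn = {c. \<exists>y. (c, y) \<in> ?G \<and> (\<forall>K. \<exists>d. 0 < d \<and>
     (\<forall>h y'. 0 < h \<and> h < d \<and> (c + h, y') \<in> ?G \<longrightarrow> y' \<le> y + K * h))}"
  define Fin where "Fin = {c. \<exists>y. (c, y) \<in> ?G \<and> (\<exists>l. \<forall>e. 0 < e \<longrightarrow> (\<exists>d. 0 < d \<and>
     (\<forall>h y'. 0 < h \<and> h < d \<and> (c + h, y') \<in> ?G \<longrightarrow> norm (y' - y - l * h) \<le> e * h)))}"
  have dfn: "definable Up" "definable Dn" "definable Fin"
    unfolding Up_def Dn_def Fin_def by (intro definable_intros poly_intros G)+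
  have ev: "(\<exists>d. 0 < d \<and> (\<forall>h y'. 0 < h \<and> h < d \<and> (c + h, y') \<in> ?G \<longrightarrow> P h y')) \<longleftrightarrow>
       eventually (\<lambda>h. P h (g (c + h))) (at_right 0)" if "c \<in> {a0<..<b0}" for c P
  proof
    assume "\<exists>d. 0 < d \<and> (\<forall>h y'. 0 < h \<and> h < d \<and> (c + h, y') \<in> ?G \<longrightarrow> P h y')"
    then obtain d where d: "0 < d" "\<forall>h y'. 0 < h \<and> h < d \<and> (c + h, y') \<in> ?G \<longrightarrow> P h y'" by blast
    have "P h (g (c + h))" if "0 < h" "h < min d (b0 - c)" for h
      using d(2) that \<open>c \<in> {a0<..<b0}\<close> by auto
    then show "eventually (\<lambda>h. P h (g (c + h))) (at_right 0)"
      unfolding eventually_at_right_field using d(1) that by (intro exI[of _ "min d (b0 - c)"]) auto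
  next
    assume "eventually (\<lambda>h. P h (g (c + h))) (at_right 0)"
    then obtain d where "0 < d" "\<forall>h>0. h < d \<longrightarrow> P h (g (c + h))"
      unfolding eventually_at_right_field by blast
    then show "\<exists>d. 0 < d \<and> (\<forall>h y'. 0 < h \<and> h < d \<and> (c + h, y') \<in> ?G \<longrightarrow> P h y')"
      by (intro exI[of _ d]) auto
  qed
  have ex: "(\<exists>y. (c, y) \<in> ?G \<and> Q y) \<longleftrightarrow> c \<in> {a0<..<b0} \<and> Q (g c)" for c Q by blast
  have Up: "c \<in> Up \<longleftrightarrow> c \<in> {a0<..<b0} \<and> (\<forall>K. eventually (\<lambda>h. g c + K * h \<le> g (c + h)) (at_right 0))"
   and Dn: "c \<in> Dn \<longleftrightarrow> c \<in> {a0<..<b0} \<and> (\<forall>K. eventually (\<lambda>h. g (c + h) \<le> g c + K * h) (at_right 0))"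
   and Fin: "c \<in> Fin \<longleftrightarrow> c \<in> {a0<..<b0} \<and>
       (\<exists>l. \<forall>e>0. eventually (\<lambda>h. norm (g (c + h) - g c - l * h) \<le> e * h) (at_right 0))" for c
    unfolding Up_def Dn_def Fin_def mem_Collect_eq ex
    by (cases "c \<in> {a0<..<b0}"; simp only: ev simp_thms)+
  have cover: "{a0<..<b0} \<subseteq> (\<Union>D\<in>{Up, Dn, Fin}. D)"
  proof
    fix c assume c: "c \<in> {a0<..<b0}"
    define U where "U = {K. eventually (\<lambda>h. g c + K * h \<le> g (c + h)) (at_right 0)}"
    have notU: "eventually (\<lambda>h. g (c + h) \<le> g c + K * h) (at_right 0)" if K: "K \<notin> U" for K
    proof -
      have "definable {h. \<exists>y'. (c + h, y') \<in> ?G \<and> g c + K * h \<le> y'}" (is "definable ?A")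
        by (intro definable_intros poly_intros G)
      from definable_right_germ[OF this, of 0]
      have *: "eventually (\<lambda>h. h \<notin> ?A) (at_right 0)"
      proof
        assume "eventually (\<lambda>h. h \<in> ?A) (at_right 0)"
        then have "eventually (\<lambda>h. g c + K * h \<le> g (c + h)) (at_right 0)"
          by (rule eventually_mono) auto
        then show ?thesis using K by (simp add: U_def)
      qed
      have "eventually (\<lambda>h. 0 < h \<and> h < b0 - c) (at_right 0)"
        using eventually_at_right_real[of 0 "b0 - c"] c by (auto elim: eventually_mono)
      with * show ?thesis
      proof eventually_elim
        case (elim h)
        then have "c + h \<in> {a0<..<b0}" using c by auto
        then have "(c + h, g (c + h)) \<in> ?G" by blast
        then have "\<not> g c + K * h \<le> g (c + h)" using elim(1) by blast
        then show ?case by simp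
      qed
    qed
    have Udown: "K' \<in> U" if "K \<in> U" "K' \<le> K" for K K'
    proof -
      have "eventually (\<lambda>h. g c + K * h \<le> g (c + h)) (at_right 0)" using that by (simp add: U_def)
      then have "eventually (\<lambda>h. g c + K' * h \<le> g (c + h)) (at_right 0)"
        using eventually_at_right_less[of 0]
      proof eventually_elim
        case (elim h)
        then have "K' * h \<le> K * h" using that(2) by (intro mult_right_mono) auto
        then show ?case using elim by linarith
      qed
      then show ?thesis by (simp add: U_def)
    qed
    consider "U = UNIV" | "U = {}" | K0 K1 where "K0 \<in> U" "K1 \<notin> U" by blast
    then have "c \<in> Up \<or> c \<in> Dn \<or> c \<in> Fin"
    proof cases
      case 1
      then show ?thesis using Up c by (auto simp: U_def)
    next
      case 2
      then show ?thesis using Dn c notU by auto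
    next
      case 3
      have K1: "K \<le> K1" if "K \<in> U" for K using Udown[OF that, of K1] 3(2) by force
      then have bdd: "bdd_above U" by (auto simp: bdd_above_def)
      have "eventually (\<lambda>h. norm (g (c + h) - g c - Sup U * h) \<le> e * h) (at_right 0)" if e: "e > 0" for e
      proof -
        obtain K where "K \<in> U" "Sup U - e < K" using less_cSupD[of U "Sup U - e"] 3(1) e by auto
        then have "Sup U - e \<in> U" using Udown by simp
        moreover have "Sup U + e \<notin> U" using cSup_upper[OF _ bdd, of "Sup U + e"] \<open>e > 0\<close> by auto
        ultimately have "eventually (\<lambda>h. g c + (Sup U - e) * h \<le> g (c + h)) (at_right 0)"
          "eventually (\<lambda>h. g (c + h) \<le> g c + (Sup U + e) * h) (at_right 0)"
          using notU by (auto simp: U_def)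
        then show ?thesis by eventually_elim (auto simp: algebra_simps abs_le_iff)
      qed
      then show ?thesis using Fin c by blast
    qed
    then show "c \<in> (\<Union>D\<in>{Up, Dn, Fin}. D)" by blast
  qed
  have def3: "definable D" if "D \<in> {Up, Dn, Fin}" for D using dfn that by blast
  have cnt: "countable {Up, Dn, Fin}" by simp
  obtain D a' b' where i: "D \<in> {Up, Dn, Fin}" "a' < b'" "{a'<..<b'} \<subseteq> {a0<..<b0}" "{a'<..<b'} \<subseteq> D"
    by (rule definable_countable_cover[OF ab0(1) cnt cover def3])
  define x where "x = a' + (b' - a') / 3"
  define y where "y = a' + (b' - a') * (2 / 3)"
  have xy: "x < y" "{x..y} \<subseteq> {a'<..<b'}" using i(2) by (auto simp: x_def y_def field_simps)
  have contxy: "continuous_on {x..y} g" using cont xy(2) i(3) by (blast intro: continuous_on_subset)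
  define K where "K = (\<bar>g y - g x\<bar> + 1) / (y - x)"
  have K: "K * (y - x) = \<bar>g y - g x\<bar> + 1" using xy(1) by (simp add: K_def)
  have "D \<noteq> Up"
  proof
    assume "D = Up"
    then have *: "eventually (\<lambda>h. - g (c + h) \<le> - g c + (- K) * h) (at_right 0)" if "x \<le> c" "c < y" for c
    proof -
      have "c \<in> {x..y}" using that by simp
      then have "c \<in> Up" using xy(2) i(4) \<open>D = Up\<close> by blast
      then have "eventually (\<lambda>h. g c + K * h \<le> g (c + h)) (at_right 0)" using Up by blast
      then show ?thesis by (rule eventually_mono) simp
    qed
    have "- g y \<le> - g x + (- K) * (y - x)"
      by (rule right_increments_bound) (use contxy xy(1) * in \<open>auto intro: continuous_on_minus\<close>)
    then show False using K by simp
  qed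
  moreover have "D \<noteq> Dn"
  proof
    assume "D = Dn"
    then have *: "eventually (\<lambda>h. g (c + h) \<le> g c + (- K) * h) (at_right 0)" if "x \<le> c" "c < y" for c
    proof -
      have "c \<in> {x..y}" using that by simp
      then have "c \<in> Dn" using xy(2) i(4) \<open>D = Dn\<close> by blast
      then show ?thesis using Dn by blast
    qed
    have "g y \<le> g x + (- K) * (y - x)"
      by (rule right_increments_bound) (use contxy xy(1) * in auto)
    then show False using K by simp
  qed
  ultimately have "{a'<..<b'} \<subseteq> Fin" using i(1,4) by blast
  moreover have "\<exists>l. ((\<lambda>h. (g (c + h) - g c) / h) \<longlongrightarrow> l) (at_right 0)" if c: "c \<in> Fin" for c
  proof -
    obtain l where l: "\<And>e. e > 0 \<Longrightarrow> eventually (\<lambda>h. norm (g (c + h) - g c - l * h) \<le> e * h) (at_right 0)"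
      using c Fin by blast
    have "((\<lambda>h. (g (c + h) - g c) / h) \<longlongrightarrow> l) (at_right 0)"
      unfolding tendsto_iff
    proof (intro allI impI)
      fix e :: real assume "e > 0"
      then have "eventually (\<lambda>h. norm (g (c + h) - g c - l * h) \<le> (e/2) * h) (at_right 0)"
        by (intro l) simp
      then show "eventually (\<lambda>h. dist ((g (c + h) - g c) / h) l < e) (at_right 0)"
        using eventually_at_right_less[of 0]
      proof eventually_elim
        case (elim h)
        have "dist ((g (c + h) - g c) / h) l = norm (g (c + h) - g c - l * h) / h"
          using elim(2) by (simp add: dist_norm field_simps abs_divide)
        also have "\<dots> \<le> e / 2" using elim by (simp add: divide_le_eq)
        finally show ?case using \<open>e > 0\<close> by simp
      qed
    qed
    then show ?thesis by blast
  qed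
  ultimately show ?thesis using i(2,3) ab0(2) by (intro exI[of _ a'] exI[of _ b']) blast
qed

lemma definable_right_derivative:
  fixes g :: "real \<Rightarrow> 'a::euclidean_space"
  assumes "a < b" "definable (graph_on {a<..<b} g)"
  shows "\<exists>c d. c < d \<and> {c<..<d} \<subseteq> {a<..<b} \<and>
    (\<forall>x\<in>{c<..<d}. \<exists>l. ((\<lambda>h. (g (x + h) - g x) /\<^sub>R h) \<longlongrightarrow> l) (at_right 0))"
proof -
  have "\<exists>c d. c < d \<and> {c<..<d} \<subseteq> {a<..<b} \<and> (\<forall>i\<in>Basis. \<forall>x\<in>{c<..<d}.
      \<exists>l. ((\<lambda>h. (g (x + h) \<bullet> i - g x \<bullet> i) / h) \<longlongrightarrow> l) (at_right 0))"
  proof (rule common_subinterval)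
    fix i :: 'a and a' b' :: real assume "a' < b'" "{a'<..<b'} \<subseteq> {a<..<b}"
    then show "\<exists>c d. c < d \<and> {c<..<d} \<subseteq> {a'<..<b'} \<and> (\<forall>x\<in>{c<..<d}.
      \<exists>l. ((\<lambda>h. (g (x + h) \<bullet> i - g x \<bullet> i) / h) \<longlongrightarrow> l) (at_right 0))"
      by (intro definable_right_derivative_scalar definable_graph_on_inner
          definable_graph_on_subset[OF assms(2) definable_interval])
  qed (use assms(1) in auto)
  then obtain c d where cd: "c < d" "{c<..<d} \<subseteq> {a<..<b}" "\<forall>i\<in>Basis. \<forall>x\<in>{c<..<d}.
      \<exists>l. ((\<lambda>h. (g (x + h) \<bullet> i - g x \<bullet> i) / h) \<longlongrightarrow> l) (at_right 0)" by blast
  have "\<exists>l. ((\<lambda>h. (g (x + h) - g x) /\<^sub>R h) \<longlongrightarrow> l) (at_right 0)" if x: "x \<in> {c<..<d}" for x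
  proof -
    obtain l where l: "\<forall>i\<in>Basis. ((\<lambda>h. (g (x + h) \<bullet> i - g x \<bullet> i) / h) \<longlongrightarrow> l i) (at_right 0)"
      using bchoice[of Basis "\<lambda>i l. ((\<lambda>h. (g (x + h) \<bullet> i - g x \<bullet> i) / h) \<longlongrightarrow> l) (at_right 0)"]
        cd(3) x by blast
    have "((\<lambda>h. \<Sum>i\<in>Basis. ((g (x + h) \<bullet> i - g x \<bullet> i) / h) *\<^sub>R i) \<longlongrightarrow> (\<Sum>i\<in>Basis. l i *\<^sub>R i)) (at_right 0)"
      using l by (intro tendsto_sum tendsto_scaleR tendsto_const) auto
    moreover have "(\<Sum>i\<in>Basis. ((g (x + h) \<bullet> i - g x \<bullet> i) / h) *\<^sub>R i) = (g (x + h) - g x) /\<^sub>R h" for h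
    proof -
      have "(\<Sum>i\<in>Basis. (((g (x + h) - g x) /\<^sub>R h) \<bullet> i) *\<^sub>R i) = (g (x + h) - g x) /\<^sub>R h"
        by (rule euclidean_representation)
      then show ?thesis by (simp add: inner_diff_left divide_inverse mult.commute)
    qed
    ultimately show ?thesis by auto
  qed
  then show ?thesis using cd(1,2) by blast
qed

end

section \<open>A definable Sard theorem\<close>

text \<open>The vector \<open>v\<close> is a limit of secant directions of \<open>M\<close> at \<open>p\<close>, approached at every small scale. In
contrast to velocities of curves this is a first-order notion.\<close>

definition approach_vector :: "'a::real_normed_vector set \<Rightarrow> 'a \<Rightarrow> 'a \<Rightarrow> bool" where
  "approach_vector M p v \<longleftrightarrow>
     (\<forall>e. 0 < e \<longrightarrow> (\<exists>d. 0 < d \<and> (\<forall>t. 0 < t \<and> t < d \<longrightarrow> (\<exists>x. x \<in> M \<and> norm (x - p - t *\<^sub>R v) \<le> e * t))))"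

text \<open>The points of \<open>M\<close> in direction \<open>v\<close> can be chosen such that \<open>f\<close> does not vary to first order.\<close>

definition level_vector :: "'a::real_normed_vector set \<Rightarrow> ('a \<Rightarrow> real) \<Rightarrow> 'a \<Rightarrow> 'a \<Rightarrow> bool" where
  "level_vector M f p v \<longleftrightarrow>
     (\<forall>e. 0 < e \<longrightarrow> (\<exists>d. 0 < d \<and> (\<forall>t. 0 < t \<and> t < d \<longrightarrow>
        (\<exists>x. x \<in> M \<and> norm (x - p - t *\<^sub>R v) \<le> e * t \<and> norm (f x - f p) \<le> e * t))))"

definition split_critical :: "'a::real_normed_vector set \<Rightarrow> ('a \<Rightarrow> real) \<Rightarrow> 'a set" where
  "split_critical M f =
     {p. p \<in> M \<and> (\<forall>v. approach_vector M p v \<longrightarrow>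
        (\<exists>a b. v = a - b \<and> level_vector M f p a \<and> level_vector M f p b))}"

text \<open>Along a definable curve of split critical points parametrized by its value, the two level directions
lead from two nearby points of the curve to points so close to each other that the Lipschitz condition
forces the values at the start to agree up to a small multiple of their difference.\<close>

theorem (in o_minimal) finite_split_critical_values:
  fixes f :: "'a::euclidean_space \<Rightarrow> real"
  assumes G: "definable (graph_on M f)" and "bounded M" and "L-lipschitz_on M f"
  shows "finite (f ` split_critical M f)"
proof (rule ccontr)
  assume inf: "infinite (f ` split_critical M f)"
  let ?G = "graph_on M f"
  have inM: "(\<exists>x. x \<in> M \<and> P x (f x)) \<longleftrightarrow> (\<exists>x r. (x, r) \<in> ?G \<and> P x r)" for P by blast
  define LV where "LV = {w :: ('a \<times> real) \<times> 'a. \<forall>e. 0 < e \<longrightarrow> (\<exists>d. 0 < d \<and> (\<forall>t. 0 < t \<and> t < d \<longrightarrow>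
        (\<exists>x r. (x, r) \<in> ?G \<and> norm (x - fst (fst w) - t *\<^sub>R snd w) \<le> e * t \<and> norm (r - snd (fst w)) \<le> e * t)))}"
  have LVd: "definable LV" unfolding LV_def by (intro definable_intros poly_intros G)
  have LV: "((p, f p), v) \<in> LV \<longleftrightarrow> level_vector M f p v" for p v
    unfolding LV_def level_vector_def mem_Collect_eq fst_conv snd_conv
    using inM[of "\<lambda>x r. norm (x - p - _ *\<^sub>R v) \<le> _ \<and> norm (r - f p) \<le> _"] by simp
  define AV where "AV = {w :: 'a \<times> 'a. \<forall>e. 0 < e \<longrightarrow> (\<exists>d. 0 < d \<and> (\<forall>t. 0 < t \<and> t < d \<longrightarrow>
        (\<exists>x r. (x, r) \<in> ?G \<and> norm (x - fst w - t *\<^sub>R snd w) \<le> e * t)))}"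
  have AVd: "definable AV" unfolding AV_def by (intro definable_intros poly_intros G)
  have AV: "(p, v) \<in> AV \<longleftrightarrow> approach_vector M p v" for p v
    unfolding AV_def approach_vector_def mem_Collect_eq fst_conv snd_conv
    using inM[of "\<lambda>x r. norm (x - p - _ *\<^sub>R v) \<le> _"] by simp
  define CR where "CR = {w. w \<in> ?G \<and> (\<forall>v. (fst w, v) \<in> AV \<longrightarrow>
      (\<exists>a b. v = a - b \<and> (w, a) \<in> LV \<and> (w, b) \<in> LV))}"
  have CRd: "definable CR"
    unfolding CR_def by (intro definable_intros definable_eq_vec poly_intros G AVd LVd)
  have CR: "w \<in> CR \<longleftrightarrow> fst w \<in> split_critical M f \<and> snd w = f (fst w)" for w
    unfolding CR_def split_critical_def mem_Collect_eq
    by (cases w) (auto simp: AV LV)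

  have "f ` split_critical M f = {s. \<exists>p. (p, s) \<in> CR}" by (auto simp: CR)
  moreover have "definable {s. \<exists>p. (p, s) \<in> CR}" by (intro definable_intros poly_intros CRd)
  ultimately obtain \<alpha> \<beta> where \<alpha>\<beta>: "\<alpha> < \<beta>" "{\<alpha><..<\<beta>} \<subseteq> {s. \<exists>p. (p, s) \<in> CR}"
    using definable_infinite_imp_interval inf by metis

  \<comment> \<open>a definable curve of split critical points, parametrized by the value of \<open>f\<close>\<close>
  define S where "S = {w. (snd w, fst w) \<in> CR \<and> \<alpha> < fst w \<and> fst w < \<beta>}"
  have Sd: "definable S" unfolding S_def by (intro definable_intros poly_intros CRd)
  have fstS: "fst ` S = {\<alpha><..<\<beta>}" 
  proof
    show "{\<alpha><..<\<beta>} \<subseteq> fst ` S"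
    proof
      fix c assume c: "c \<in> {\<alpha><..<\<beta>}"
      then obtain p where "(p, c) \<in> CR" using \<alpha>\<beta>(2) by blast
      then have "(c, p) \<in> S" using c by (simp add: S_def)
      then show "c \<in> fst ` S" by (rule image_eqI[rotated]) simp
    qed
  qed (auto simp: S_def)
  have "bounded {p. (c, p) \<in> S}" for c
    by (rule bounded_subset[OF assms(2)]) (auto simp: S_def CR split_critical_def)
  from definable_choice[OF Sd this] obtain p where
    p: "definable (graph_on {\<alpha><..<\<beta>} p)" "\<And>c. c \<in> {\<alpha><..<\<beta>} \<Longrightarrow> (c, p c) \<in> S"
    unfolding fstS by metis
  have pcrit: "p c \<in> split_critical M f" "f (p c) = c" "p c \<in> M" if "c \<in> {\<alpha><..<\<beta>}" for c
    using p(2)[OF that] by (auto simp: S_def CR split_critical_def)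
  obtain \<alpha>1 \<beta>1 where J1: "\<alpha>1 < \<beta>1" "{\<alpha>1<..<\<beta>1} \<subseteq> {\<alpha><..<\<beta>}"
    and der: "\<And>c. c \<in> {\<alpha>1<..<\<beta>1} \<Longrightarrow> \<exists>l. ((\<lambda>h. (p (c + h) - p c) /\<^sub>R h) \<longlongrightarrow> l) (at_right 0)"
    using definable_right_derivative[OF \<alpha>\<beta>(1) p(1)] by blast
  let ?P = "graph_on {\<alpha>1<..<\<beta>1} p"
  have P: "definable ?P" by (rule definable_graph_on_subset[OF p(1) definable_interval J1(2)])

  \<comment> \<open>the velocity of the curve splits into two level directions\<close>
  define R where "R n = {w :: real \<times> 'a \<times> 'a. \<exists>x. (fst w, x) \<in> ?P \<and>
      ((x, fst w), fst (snd w)) \<in> LV \<and> ((x, fst w), snd (snd w)) \<in> LV \<and>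
      norm (snd w) \<le> real n \<and>
      (\<forall>e. 0 < e \<longrightarrow> (\<exists>d. 0 < d \<and> (\<forall>h y. 0 < h \<and> h < d \<and> (fst w + h, y) \<in> ?P \<longrightarrow>
          norm (y - x - h *\<^sub>R (fst (snd w) - snd (snd w))) \<le> e * h)))}" for n :: nat
  have Rd: "definable (R n)" for n
    unfolding R_def by (intro definable_intros poly_intros P LVd)
  have cover: "{\<alpha>1<..<\<beta>1} \<subseteq> (\<Union>n\<in>UNIV. {c. \<exists>z. (c, z) \<in> R n})"
  proof
    fix c assume c: "c \<in> {\<alpha>1<..<\<beta>1}"
    then have c0: "c \<in> {\<alpha><..<\<beta>}" using J1(2) by blast
    obtain v where v: "((\<lambda>h. (p (c + h) - p c) /\<^sub>R h) \<longlongrightarrow> v) (at_right 0)" using der[OF c] by blast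
    have rd: "\<exists>d. 0 < d \<and> d \<le> \<beta>1 - c \<and> (\<forall>h. 0 < h \<and> h < d \<longrightarrow> norm (p (c + h) - p c - h *\<^sub>R v) \<le> e * h)"
      if e: "0 < e" for e
    proof -
      have "eventually (\<lambda>h. dist ((p (c + h) - p c) /\<^sub>R h) v < e) (at_right 0)"
        using v e by (rule tendstoD)
      then obtain d where d: "d > 0" "\<And>h. 0 < h \<Longrightarrow> h < d \<Longrightarrow> dist ((p (c + h) - p c) /\<^sub>R h) v < e"
        unfolding eventually_at_right_field by blast
      show ?thesis
      proof (intro exI[of _ "min d (\<beta>1 - c)"] conjI allI impI)
        fix h assume h: "0 < h \<and> h < min d (\<beta>1 - c)"
        have "p (c + h) - p c - h *\<^sub>R v = h *\<^sub>R ((p (c + h) - p c) /\<^sub>R h - v)"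
          using h by (simp add: scaleR_diff_right)
        then have "norm (p (c + h) - p c - h *\<^sub>R v) = h * dist ((p (c + h) - p c) /\<^sub>R h) v"
          using h by (simp add: dist_norm)
        also have "\<dots> \<le> h * e" using d(2)[of h] h by (intro mult_left_mono) auto
        finally show "norm (p (c + h) - p c - h *\<^sub>R v) \<le> e * h" by (simp add: mult.commute)
      qed (use d(1) c in auto)
    qed
    have "approach_vector M (p c) v"
      unfolding approach_vector_def
    proof (intro allI impI)
      fix e :: real assume "0 < e"
      from rd[OF this] obtain d where d: "0 < d" "d \<le> \<beta>1 - c"
        "\<And>h. 0 < h \<and> h < d \<Longrightarrow> norm (p (c + h) - p c - h *\<^sub>R v) \<le> e * h" by blast
      have "p (c + t) \<in> M" if "0 < t \<and> t < d" for t
        using that d(2) c J1(2) by (intro pcrit(3)) (auto simp: subset_iff)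
      then show "\<exists>d. 0 < d \<and> (\<forall>t. 0 < t \<and> t < d \<longrightarrow> (\<exists>x. x \<in> M \<and> norm (x - p c - t *\<^sub>R v) \<le> e * t))"
        using d(1,3) by (intro exI[of _ d]) blast
    qed
    then obtain a b where ab: "v = a - b" "level_vector M f (p c) a" "level_vector M f (p c) b"
      using pcrit(1)[OF c0] unfolding split_critical_def by blast
    obtain n where n: "norm (a, b) \<le> real n" using real_arch_simple by blast
    have "(c, a, b) \<in> R n"
      unfolding R_def mem_Collect_eq fst_conv snd_conv
    proof (intro exI[of _ "p c"] conjI allI impI)
      show "((p c, c), a) \<in> LV" "((p c, c), b) \<in> LV"
        using ab(2,3) LV[of "p c"] pcrit(2)[OF c0] by simp_all
      fix e :: real assume "0 < e"
      from rd[OF this] obtain d where "0 < d"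
        "\<And>h. 0 < h \<and> h < d \<Longrightarrow> norm (p (c + h) - p c - h *\<^sub>R v) \<le> e * h" by blast
      then show "\<exists>d. 0 < d \<and> (\<forall>h y. 0 < h \<and> h < d \<and> (c + h, y) \<in> ?P \<longrightarrow> norm (y - p c - h *\<^sub>R (a - b)) \<le> e * h)"
        by (intro exI[of _ d]) (auto simp: ab(1))
    qed (use c n in auto)
    then show "c \<in> (\<Union>n\<in>UNIV. {c. \<exists>z. (c, z) \<in> R n})" by blast
  qed
  have Rd': "definable {c. \<exists>z. (c, z) \<in> R n}" for n by (intro definable_intros poly_intros Rd)
  obtain n \<alpha>2 \<beta>2 where J2: "\<alpha>2 < \<beta>2" "{\<alpha>2<..<\<beta>2} \<subseteq> {\<alpha>1<..<\<beta>1}" "{\<alpha>2<..<\<beta>2} \<subseteq> {c. \<exists>z. (c, z) \<in> R n}"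
    by (rule definable_countable_cover[OF J1(1) _ cover Rd']) simp_all
  define R2 where "R2 = {w. w \<in> R n \<and> \<alpha>2 < fst w \<and> fst w < \<beta>2}"
  have R2d: "definable R2" unfolding R2_def by (intro definable_intros poly_intros Rd)
  have fstR2: "fst ` R2 = {\<alpha>2<..<\<beta>2}" 
  proof
    show "{\<alpha>2<..<\<beta>2} \<subseteq> fst ` R2"
    proof
      fix c assume c: "c \<in> {\<alpha>2<..<\<beta>2}"
      then obtain z where "(c, z) \<in> R n" using J2(3) by blast
      then have "(c, z) \<in> R2" using c by (simp add: R2_def)
      then show "c \<in> fst ` R2" by (rule image_eqI[rotated]) simp
    qed
  qed (auto simp: R2_def)
  have "bounded {z. (c, z) \<in> R2}" for c
    by (rule boundedI[of _ "real n"]) (auto simp: R2_def R_def)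
  from definable_choice[OF R2d this] obtain g where
    g: "definable (graph_on {\<alpha>2<..<\<beta>2} g)" "\<And>c. c \<in> {\<alpha>2<..<\<beta>2} \<Longrightarrow> (c, g c) \<in> R2"
    unfolding fstR2 by metis
  obtain \<alpha>3 \<beta>3 where J3: "\<alpha>3 < \<beta>3" "{\<alpha>3<..<\<beta>3} \<subseteq> {\<alpha>2<..<\<beta>2}" and cont: "continuous_on {\<alpha>3<..<\<beta>3} g"
    using definable_continuous[OF J2(1) g(1)] by blast
  have J31: "{\<alpha>3<..<\<beta>3} \<subseteq> {\<alpha>1<..<\<beta>1}" using J3(2) J2(2) by blast
  have J30: "{\<alpha>3<..<\<beta>3} \<subseteq> {\<alpha><..<\<beta>}" using J31 J1(2) by blast
  have gR: "level_vector M f (p c) (fst (g c))" "level_vector M f (p c) (snd (g c))"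
    "\<And>e. 0 < e \<Longrightarrow> \<exists>d>0. \<forall>h y. 0 < h \<and> h < d \<and> (c + h, y) \<in> ?P \<longrightarrow>
          norm (y - p c - h *\<^sub>R (fst (g c) - snd (g c))) \<le> e * h"
    if "c \<in> {\<alpha>3<..<\<beta>3}" for c
  proof -
    have "(c, g c) \<in> R n" using g(2) that J3(2) by (auto simp: R2_def)
    then obtain x where x: "(c, x) \<in> ?P" "((x, c), fst (g c)) \<in> LV" "((x, c), snd (g c)) \<in> LV"
      "\<forall>e. 0 < e \<longrightarrow> (\<exists>d. 0 < d \<and> (\<forall>h y. 0 < h \<and> h < d \<and> (c + h, y) \<in> ?P \<longrightarrow>
          norm (y - x - h *\<^sub>R (fst (g c) - snd (g c))) \<le> e * h))"
      unfolding R_def mem_Collect_eq fst_conv snd_conv by blast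
    have "x = p c" using x(1) by auto
    moreover have "f (p c) = c" using pcrit(2) that J30 by blast
    ultimately show "level_vector M f (p c) (fst (g c))" "level_vector M f (p c) (snd (g c))"
      "\<And>e. 0 < e \<Longrightarrow> \<exists>d>0. \<forall>h y. 0 < h \<and> h < d \<and> (c + h, y) \<in> ?P \<longrightarrow>
          norm (y - p c - h *\<^sub>R (fst (g c) - snd (g c))) \<le> e * h"
      using x(2-4) LV[of "p c"] by auto
  qed

  \<comment> \<open>on a smaller interval the second level direction is followed at a uniform scale\<close>
  have L: "L \<ge> 0" using assms(3) by (rule lipschitz_on_nonneg)
  \<comment> \<open>the final comparison yields \<open>t \<le> (4 L \<eta> + 2 \<eta>) t\<close>, which has to be absurd\<close>
  define \<eta> where "\<eta> = 1 / (8 * (L + 1))"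
  have "\<eta> > 0" using L by (simp add: \<eta>_def)
  moreover have "\<eta> * (8 * (L + 1)) = 1" using L by (simp add: \<eta>_def)
  ultimately have \<eta>: "\<eta> > 0" "4 * L * \<eta> + 2 * \<eta> < 1" by (simp_all add: algebra_simps)
  let ?P3 = "graph_on {\<alpha>3<..<\<beta>3} p" and ?g3 = "graph_on {\<alpha>3<..<\<beta>3} g"
  have P3: "definable ?P3" by (rule definable_graph_on_subset[OF P definable_interval J31])
  have g3: "definable ?g3" by (rule definable_graph_on_subset[OF g(1) definable_interval J3(2)])
  define D where "D m = {c. \<exists>x z. (c, x) \<in> ?P3 \<and> (c, z) \<in> ?g3 \<and> (\<forall>t. 0 < t \<and> t < inverse (real (Suc m)) \<longrightarrow>
     (\<exists>y r. (y, r) \<in> ?G \<and> norm (y - x - t *\<^sub>R snd z) \<le> \<eta> * t \<and> norm (r - c) \<le> \<eta> * t))}" for m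
  have Dd: "definable (D m)" for m
    unfolding D_def by (intro definable_intros poly_intros P3 g3 G)
  have cover: "{\<alpha>3<..<\<beta>3} \<subseteq> (\<Union>m\<in>UNIV. D m)"
  proof
    fix c assume c: "c \<in> {\<alpha>3<..<\<beta>3}"
    have fc: "f (p c) = c" using pcrit(2) c J30 by blast
    obtain d where d: "0 < d" "\<And>t. 0 < t \<and> t < d \<Longrightarrow>
        \<exists>x. x \<in> M \<and> norm (x - p c - t *\<^sub>R snd (g c)) \<le> \<eta> * t \<and> norm (f x - c) \<le> \<eta> * t"
      using gR(2)[OF c] \<eta>(1) unfolding level_vector_def fc by blast
    obtain m where m: "inverse (real (Suc m)) < d" using reals_Archimedean[OF d(1)] by blast
    have "\<exists>y r. (y, r) \<in> ?G \<and> norm (y - p c - t *\<^sub>R snd (g c)) \<le> \<eta> * t \<and> norm (r - c) \<le> \<eta> * t"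
      if "0 < t \<and> t < inverse (real (Suc m))" for t
    proof -
      have "0 < t \<and> t < d" using that m by simp
      from d(2)[OF this] show ?thesis by blast
    qed
    moreover have "(c, p c) \<in> ?P3" "(c, g c) \<in> ?g3" using c by blast+
    ultimately have "c \<in> D m" unfolding D_def by blast
    then show "c \<in> (\<Union>m\<in>UNIV. D m)" by blast
  qed
  obtain m \<alpha>4 \<beta>4 where J4: "\<alpha>4 < \<beta>4" "{\<alpha>4<..<\<beta>4} \<subseteq> {\<alpha>3<..<\<beta>3}" "{\<alpha>4<..<\<beta>4} \<subseteq> D m"
    by (rule definable_countable_cover[OF J3(1) _ cover Dd]) simp_all

  \<comment> \<open>two nearby points of \<open>M\<close> whose values differ too much\<close>
  define c where "c = (\<alpha>4 + \<beta>4) / 2"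
  have c4: "c \<in> {\<alpha>4<..<\<beta>4}" using J4(1) by (simp add: c_def)
  then have c3: "c \<in> {\<alpha>3<..<\<beta>3}" using J4(2) by blast
  have fc: "f (p c) = c" using pcrit(2) c3 J30 by blast
  obtain d1 where d1: "0 < d1" "\<And>t. 0 < t \<and> t < d1 \<Longrightarrow>
        \<exists>x. x \<in> M \<and> norm (x - p c - t *\<^sub>R fst (g c)) \<le> \<eta> * t \<and> norm (f x - c) \<le> \<eta> * t"
    using gR(1)[OF c3] \<eta>(1) unfolding level_vector_def fc by blast
  obtain d2 where d2: "0 < d2" "\<And>h y. 0 < h \<and> h < d2 \<and> (c + h, y) \<in> ?P \<Longrightarrow>
        norm (y - p c - h *\<^sub>R (fst (g c) - snd (g c))) \<le> \<eta> * h"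
    using gR(3)[OF c3 \<eta>(1)] by blast
  obtain d3 where d3: "0 < d3" "\<And>c'. c' \<in> {\<alpha>3<..<\<beta>3} \<Longrightarrow> dist c' c < d3 \<Longrightarrow> dist (g c') (g c) < \<eta>"
    using cont c3 \<eta>(1) unfolding continuous_on_iff by blast
  have "0 < min (min d1 d2) (min d3 (min (inverse (real (Suc m))) (\<beta>4 - c)))"
    using d1(1) d2(1) d3(1) c4 by simp
  from dense[OF this] obtain t
    where t: "0 < t" "t < d1" "t < d2" "t < d3" "t < inverse (real (Suc m))" "t < \<beta>4 - c"
    by auto
  have ct4: "c + t \<in> {\<alpha>4<..<\<beta>4}" using c4 t by auto
  then have ct3: "c + t \<in> {\<alpha>3<..<\<beta>3}" using J4(2) by blast
  let ?q = "p (c + t)" and ?b = "snd (g c)" and ?b' = "snd (g (c + t))" and ?a = "fst (g c)"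
  obtain x where x: "x \<in> M" "norm (x - p c - t *\<^sub>R ?a) \<le> \<eta> * t" "norm (f x - c) \<le> \<eta> * t"
    using d1(2) t by blast
  have "c + t \<in> D m" using J4(3) ct4 by blast
  then obtain x' z' where "(c + t, x') \<in> ?P3" "(c + t, z') \<in> ?g3"
    and D: "\<forall>s. 0 < s \<and> s < inverse (real (Suc m)) \<longrightarrow>
     (\<exists>y r. (y, r) \<in> ?G \<and> norm (y - x' - s *\<^sub>R snd z') \<le> \<eta> * s \<and> norm (r - (c + t)) \<le> \<eta> * s)"
    unfolding D_def by blast
  then have "x' = ?q" "z' = g (c + t)" by auto
  with D t obtain y where y: "y \<in> M" "norm (y - ?q - t *\<^sub>R ?b') \<le> \<eta> * t" "norm (f y - (c + t)) \<le> \<eta> * t"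
    by fastforce
  have "(c + t, ?q) \<in> ?P" using ct3 J31 by blast
  then have q: "norm (?q - p c - t *\<^sub>R (?a - ?b)) \<le> \<eta> * t" using d2(2) t by blast
  have "dist (g (c + t)) (g c) < \<eta>" using d3(2)[OF ct3] t by (simp add: dist_norm)
  moreover have "norm (?b' - ?b) \<le> dist (g (c + t)) (g c)"
    using dist_snd_le[of "g (c + t)" "g c"] by (simp add: dist_norm)
  ultimately have "norm (t *\<^sub>R (?b' - ?b)) \<le> \<eta> * t"
    using t(1) by (simp add: mult.commute mult_left_mono)
  moreover have "y - x = (y - ?q - t *\<^sub>R ?b') + (?q - p c - t *\<^sub>R (?a - ?b)) + t *\<^sub>R (?b' - ?b) - (x - p c - t *\<^sub>R ?a)"
    by (simp add: algebra_simps)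
  ultimately have "norm (y - x) \<le> 4 * (\<eta> * t)"
    using x(2) y(2) q norm_triangle_ineq4 norm_triangle_ineq
    by (smt (verit))
  then have "norm (f y - f x) \<le> L * (4 * (\<eta> * t))"
    using lipschitz_on_normD[OF assms(3) y(1) x(1)] L mult_left_mono order_trans by blast
  then have "t - 2 * (\<eta> * t) \<le> 4 * L * \<eta> * t"
    using x(3) y(3) by (simp add: algebra_simps abs_le_iff)
  then have "t \<le> (4 * L * \<eta> + 2 * \<eta>) * t" by (simp add: algebra_simps)
  then show False using t(1) \<eta>(2) by (simp add: mult_le_cancel_right1)
qed

section \<open>Integral curves on a compact submanifold\<close>

lemma tangent_space_approach:
  assumes "v \<in> tangent_space M p"
  shows "approach_vector M p v" "approach_vector M p (- v)"
proof -
  obtain c e where c: "0 < e" "c ` {-e<..<e} \<subseteq> M" "c 0 = p" "(c has_vector_derivative v) (at (0::real))"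
    using assms unfolding tangent_space_def by blast
  have *: "\<exists>d>0. d \<le> e \<and> (\<forall>t. \<bar>t\<bar> < d \<longrightarrow> norm (c t - p - t *\<^sub>R v) \<le> \<epsilon> * \<bar>t\<bar>)" if \<epsilon>: "0 < \<epsilon>" for \<epsilon>
  proof -
    have "(c has_derivative (\<lambda>t. t *\<^sub>R v)) (at 0)" using c(4) by (simp add: has_vector_derivative_def)
    then obtain d where d: "0 < d" "\<And>t. norm (t - 0) < d \<Longrightarrow> norm (c t - c 0 - (t - 0) *\<^sub>R v) \<le> \<epsilon> * norm (t - 0)"
      unfolding has_derivative_at_alt using \<epsilon> by blast
    then show ?thesis using c(1,3) by (intro exI[of _ "min d e"]) auto
  qed
  have M: "c t \<in> M" if "\<bar>t\<bar> < e" for t using c(2) that by (auto simp: abs_less_iff)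
  show "approach_vector M p v"
    unfolding approach_vector_def
  proof (intro allI impI)
    fix \<epsilon> :: real assume "0 < \<epsilon>"
    from *[OF this] obtain d where d: "d > 0" "d \<le> e" "\<And>t. \<bar>t\<bar> < d \<Longrightarrow> norm (c t - p - t *\<^sub>R v) \<le> \<epsilon> * \<bar>t\<bar>" by blast
    show "\<exists>d. 0 < d \<and> (\<forall>t. 0 < t \<and> t < d \<longrightarrow> (\<exists>x. x \<in> M \<and> norm (x - p - t *\<^sub>R v) \<le> \<epsilon> * t))"
    proof (intro exI[of _ d] conjI allI impI)
      fix t assume "0 < t \<and> t < d"
      then show "\<exists>x. x \<in> M \<and> norm (x - p - t *\<^sub>R v) \<le> \<epsilon> * t"
        using d(2) d(3)[of t] M[of t] by (intro exI[of _ "c t"]) auto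
    qed (fact d(1))
  qed
  show "approach_vector M p (- v)"
    unfolding approach_vector_def
  proof (intro allI impI)
    fix \<epsilon> :: real assume "0 < \<epsilon>"
    from *[OF this] obtain d where d: "d > 0" "d \<le> e" "\<And>t. \<bar>t\<bar> < d \<Longrightarrow> norm (c t - p - t *\<^sub>R v) \<le> \<epsilon> * \<bar>t\<bar>" by blast
    show "\<exists>d. 0 < d \<and> (\<forall>t. 0 < t \<and> t < d \<longrightarrow> (\<exists>x. x \<in> M \<and> norm (x - p - t *\<^sub>R (- v)) \<le> \<epsilon> * t))"
    proof (intro exI[of _ d] conjI allI impI)
      fix t assume "0 < t \<and> t < d"
      then show "\<exists>x. x \<in> M \<and> norm (x - p - t *\<^sub>R (- v)) \<le> \<epsilon> * t"
        using d(2) d(3)[of "- t"] M[of "- t"] by (intro exI[of _ "c (- t)"]) auto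
    qed (fact d(1))
  qed
qed

lemma C1_on_locally_lipschitz:
  assumes "C1_on F U" "open U" "p \<in> U"
  obtains r L where "0 < r" "L-lipschitz_on (cball p r) F"
proof -
  obtain f' where f': "\<And>x. x \<in> U \<Longrightarrow> (F has_derivative blinfun_apply (f' x)) (at x)" "continuous_on U f'"
    using assms(1) unfolding C1_on_def by blast
  obtain r1 where r1: "0 < r1" "cball p r1 \<subseteq> U" using assms(2,3) open_contains_cball by metis
  have "continuous (at p within U) f'" using f'(2) assms(3) continuous_on_eq_continuous_within by blast
  then obtain d where d: "0 < d" "\<And>x. x \<in> U \<Longrightarrow> dist x p < d \<Longrightarrow> dist (f' x) (f' p) < 1"
    unfolding continuous_within_eps_delta by (metis zero_less_one)
  define r where "r = min r1 (d / 2)"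
  let ?L = "norm (f' p) + 1"
  have r: "0 < r" "cball p r \<subseteq> U" using r1 d(1) by (auto simp: r_def)
  have B: "onorm (blinfun_apply (f' x)) \<le> ?L" if "x \<in> cball p r" for x
  proof -
    have "dist x p < d" using that d(1) by (auto simp: r_def dist_commute)
    then have "dist (f' x) (f' p) < 1" using d(2) that r(2) by blast
    then have "norm (f' x) \<le> ?L"
      using norm_triangle_sub[of "f' x" "f' p"] by (simp add: dist_norm)
    then show ?thesis by (simp add: norm_blinfun.rep_eq)
  qed
  have der: "(F has_derivative blinfun_apply (f' x)) (at x within cball p r)" if "x \<in> cball p r" for x
    using f'(1) r(2) that by (blast intro: has_derivative_at_withinI)
  have "?L-lipschitz_on (cball p r) F"
  proof (rule lipschitz_onI)
    fix x y assume xy: "x \<in> cball p r" "y \<in> cball p r"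
    have "norm (F x - F y) \<le> ?L * norm (x - y)"
      by (rule differentiable_bound[OF convex_cball der B xy])
    then show "dist (F x) (F y) \<le> ?L * dist x y" by (simp add: dist_norm)
  qed simp
  then show ?thesis using r(1) that by blast
qed

text \<open>The local extensions of \<open>X\<close> to open sets are Lipschitz on balls, and on a compact set local Lipschitz
bounds are uniform.\<close>

lemma C1_vector_field_lipschitz:
  assumes "compact M" "C1_vector_field M X"
  obtains K where "K-lipschitz_on M X"
proof -
  have "local_lipschitz {0::real} M (\<lambda>_. X)"
  proof (rule local_lipschitzI)
    fix t :: real and p assume "p \<in> M"
    then obtain U F where U: "open U" "p \<in> U" "C1_on F U" "\<forall>x\<in>M \<inter> U. F x = X x"
      using assms(2) unfolding C1_vector_field_def by blast
    obtain r L where r: "0 < r" "L-lipschitz_on (cball p r) F"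
      by (rule C1_on_locally_lipschitz[OF U(3,1,2)])
    obtain s where s: "0 < s" "cball p s \<subseteq> U" using U(1,2) open_contains_cball by metis
    have "L-lipschitz_on (cball p (min r s) \<inter> M) F"
      by (rule lipschitz_on_subset[OF r(2)]) auto
    moreover have "F x = X x" if "x \<in> cball p (min r s) \<inter> M" for x
    proof -
      have "x \<in> cball p s" using that by simp
      then show ?thesis using that s(2) U(4) by blast
    qed
    ultimately have "L-lipschitz_on (cball p (min r s) \<inter> M) X"
      using lipschitz_on_transform by fastforce
    then show "\<exists>u>0. \<exists>L. \<forall>t\<in>cball t u \<inter> {0}. L-lipschitz_on (cball p u \<inter> M) X"
      using r(1) s(1) by (intro exI[of _ "min r s"] conjI exI[of _ L]) auto
  qed
  from local_lipschitz_compact_implies_lipschitz[OF this assms(1), of thesis] that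
  show thesis by (simp add: continuous_on_const)
qed

text \<open>McShane's formula: the largest \<open>K\<close>-Lipschitz function that does not exceed \<open>u\<close> on \<open>M\<close>.\<close>

lemma lipschitz_extension_real:
  fixes u :: "'a::metric_space \<Rightarrow> real"
  assumes "K-lipschitz_on M u" "M \<noteq> {}"
  obtains g where "K-lipschitz_on UNIV g" "\<And>x. x \<in> M \<Longrightarrow> g x = u x"
proof -
  obtain y0 where y0: "y0 \<in> M" using assms(2) by blast
  have K: "0 \<le> K" using assms(1) by (rule lipschitz_on_nonneg)
  have lip: "u y \<le> u z + K * dist y z" if "y \<in> M" "z \<in> M" for y z
    using lipschitz_onD[OF assms(1) that] by (auto simp: dist_real_def abs_le_iff)
  define g where "g x = (INF y\<in>M. u y + K * dist x y)" for x
  have bdd: "bdd_below ((\<lambda>y. u y + K * dist x y) ` M)" for x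
  proof (rule bdd_belowI2)
    fix y assume y: "y \<in> M"
    have "u y0 \<le> u y + K * dist y0 y" by (rule lip[OF y0 y])
    moreover have "K * dist y0 y \<le> K * (dist x y0 + dist x y)"
      using K by (intro mult_left_mono) (metis dist_commute dist_triangle)
    ultimately show "u y0 - K * dist x y0 \<le> u y + K * dist x y" by (simp add: algebra_simps)
  qed
  have le: "g x \<le> g z + K * dist x z" for x z
  proof -
    have "g x - K * dist x z \<le> u y + K * dist z y" if y: "y \<in> M" for y
    proof -
      have "g x \<le> u y + K * dist x y" unfolding g_def by (rule cINF_lower[OF bdd y])
      moreover have "K * dist x y \<le> K * (dist x z + dist z y)"
        using K by (intro mult_left_mono dist_triangle) auto
      ultimately show ?thesis by (simp add: algebra_simps)
    qed
    then have "g x - K * dist x z \<le> g z" unfolding g_def[of z] by (rule cINF_greatest[OF assms(2)])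
    then show ?thesis by simp
  qed
  have "K-lipschitz_on UNIV g"
  proof (rule lipschitz_onI[OF _ K])
    fix x z show "dist (g x) (g z) \<le> K * dist x z"
      using le[of x z] le[of z x] by (simp add: dist_real_def abs_le_iff dist_commute)
  qed
  moreover have "g x = u x" if x: "x \<in> M" for x
  proof (rule antisym)
    show "g x \<le> u x" using cINF_lower[OF bdd x, of x] by (simp add: g_def)
    show "u x \<le> g x" unfolding g_def by (rule cINF_greatest[OF assms(2)]) (rule lip[OF x])
  qed
  ultimately show ?thesis using that by blast
qed

lemma lipschitz_extension:
  fixes X :: "'a::metric_space \<Rightarrow> 'b::euclidean_space"
  assumes "K-lipschitz_on M X" "M \<noteq> {}"
  obtains F K' where "K'-lipschitz_on UNIV F" "0 < K'" "\<And>x. x \<in> M \<Longrightarrow> F x = X x"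
proof -
  have K: "0 \<le> K" using assms(1) by (rule lipschitz_on_nonneg)
  have "\<exists>g. K-lipschitz_on UNIV g \<and> (\<forall>x\<in>M. g x = X x \<bullet> b)" if b: "b \<in> Basis" for b
  proof -
    have "K-lipschitz_on M (\<lambda>x. X x \<bullet> b)"
    proof (rule lipschitz_onI[OF _ K])
      fix x y assume "x \<in> M" "y \<in> M"
      have "dist (X x \<bullet> b) (X y \<bullet> b) = \<bar>(X x - X y) \<bullet> b\<bar>" by (simp add: dist_real_def inner_diff_left)
      also have "\<dots> \<le> dist (X x) (X y)" using Basis_le_norm[OF b] by (simp add: dist_norm)
      also have "\<dots> \<le> K * dist x y" by (rule lipschitz_onD[OF assms(1)]) fact+
      finally show "dist (X x \<bullet> b) (X y \<bullet> b) \<le> K * dist x y" .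
    qed
    then obtain h where "K-lipschitz_on UNIV h" "\<And>x. x \<in> M \<Longrightarrow> h x = X x \<bullet> b"
      by (rule lipschitz_extension_real[OF _ assms(2)]) blast
    then show ?thesis by blast
  qed
  then obtain g where g: "\<And>b. b \<in> Basis \<Longrightarrow> K-lipschitz_on UNIV (g b)"
    "\<And>b x. b \<in> Basis \<Longrightarrow> x \<in> M \<Longrightarrow> g b x = X x \<bullet> b" by metis
  define F where "F x = (\<Sum>b\<in>Basis. g b x *\<^sub>R b)" for x
  let ?K = "real DIM('b) * K + 1"
  have "?K-lipschitz_on UNIV F"
  proof (rule lipschitz_onI)
    fix x y
    have "norm (F x - F y) \<le> (\<Sum>b\<in>Basis. \<bar>(F x - F y) \<bullet> b\<bar>)" by (rule norm_le_l1)
    also have "\<dots> \<le> (\<Sum>b\<in>(Basis :: 'b set). K * dist x y)"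
    proof (rule sum_mono)
      fix b :: 'b assume b: "b \<in> Basis"
      then have "\<bar>(F x - F y) \<bullet> b\<bar> = dist (g b x) (g b y)"
        by (simp add: F_def inner_diff_left dist_real_def)
      then show "\<bar>(F x - F y) \<bullet> b\<bar> \<le> K * dist x y" using lipschitz_onD[OF g(1)[OF b]] by simp
    qed
    also have "\<dots> \<le> ?K * dist x y" by (simp add: algebra_simps)
    finally show "dist (F x) (F y) \<le> ?K * dist x y" by (simp add: dist_norm)
  qed (use K in simp)
  moreover have "F x = X x" if "x \<in> M" for x
    using g(2) that by (simp add: F_def euclidean_representation)
  moreover have "0 < ?K" using K by (simp add: add_nonneg_pos)
  ultimately show ?thesis using that by blast
qed

lemma indefinite_integral_derivative:
  fixes f :: "real \<Rightarrow> 'a::banach"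
  assumes "continuous_on {0..} f" "0 \<le> t"
  shows "((\<lambda>t. integral {0..t} f) has_vector_derivative f t) (at t within {0..})"
proof -
  have "((\<lambda>t. integral {0..t} f) has_vector_derivative f t) (at t within {0..t+1})"
    by (rule integral_has_vector_derivative) (use assms in \<open>auto intro: continuous_on_subset\<close>)
  moreover have "at t within {0..t+1} = at t within {0..}"
    by (rule at_within_nhd[of _ "{..<t+1}"]) auto
  ultimately show ?thesis by simp
qed

text \<open>Writing solutions as \<open>p + exp (2 K t) u t\<close> with \<open>u\<close> bounded makes the Picard operator a contraction
  by the factor \<open>1/2\<close> on the whole half-line, which gives the global solution in one step.\<close>

lemma picard_half_line:
  fixes F :: "'a::euclidean_space \<Rightarrow> 'a"
  assumes F: "K-lipschitz_on UNIV F" and K: "0 < K"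
  obtains c where "c 0 = p" "\<And>t. 0 \<le> t \<Longrightarrow> (c has_vector_derivative F (c t)) (at t within {0..})"
proof -
  define w where "w u s = F (p + exp (2 * K * s) *\<^sub>R u s)" for u :: "real \<Rightarrow> 'a" and s
  define I where "I u t = integral {0..t} (w u)" for u t
  \<comment> \<open>bounded continuous functions live on the whole line, hence the constant extension to \<open>t < 0\<close>\<close>
  define \<Phi> where "\<Phi> u t = exp (- 2 * K * max 0 t) *\<^sub>R I u (max 0 t)" for u t
  have contF: "continuous_on UNIV F" using F by (rule lipschitz_on_continuous_on)
  have wcont: "continuous_on S (w u)" if "continuous_on UNIV u" for u S
    unfolding w_def
    by (intro continuous_on_compose2[OF contF] continuous_intros continuous_on_subset[OF that]) auto
  have Ider: "(I u has_vector_derivative w u t) (at t within {0..})" if "continuous_on UNIV u" "0 \<le> t" for u t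
    unfolding I_def by (rule indefinite_integral_derivative[OF wcont]) fact+
  have Icont: "continuous_on {0..} (I u)" if "continuous_on UNIV u" for u
    using Ider[OF that] by (auto simp: continuous_on_eq_continuous_within intro: has_vector_derivative_continuous)
  have \<Phi>cont: "continuous_on UNIV (\<Phi> u)" if "continuous_on UNIV u" for u
    unfolding \<Phi>_def
    by (intro continuous_intros continuous_on_compose2[OF Icont[OF that], of UNIV "max 0"]) auto
  have contr: "norm (\<Phi> u t - \<Phi> v t) \<le> D / 2"
    if u: "continuous_on UNIV u" and v: "continuous_on UNIV v" and D: "\<And>s. norm (u s - v s) \<le> D" for u v t D
  proof -
    let ?t = "max 0 t"
    let ?k = "\<lambda>s. D * (K * exp (2 * K * s))"
    have D0: "0 \<le> D" using D[of 0] norm_ge_zero order_trans by blast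
    have ftc: "(?k has_integral (D * exp (2 * K * ?t) / 2 - D * exp (2 * K * 0) / 2)) {0..?t}"
      by (rule fundamental_theorem_of_calculus)
        (auto intro!: derivative_eq_intros simp: has_real_derivative_iff_has_vector_derivative[symmetric])
    have le: "norm (w u s - w v s) \<le> ?k s" for s
    proof -
      have "norm (w u s - w v s) \<le> K * norm (exp (2 * K * s) *\<^sub>R (u s - v s))"
        unfolding w_def using lipschitz_on_normD[OF F, of "p + exp (2 * K * s) *\<^sub>R u s" "p + exp (2 * K * s) *\<^sub>R v s"]
        by (simp add: scaleR_diff_right)
      also have "\<dots> = (K * exp (2 * K * s)) * norm (u s - v s)" by simp
      also have "\<dots> \<le> (K * exp (2 * K * s)) * D" using K D by (intro mult_left_mono) auto
      finally show ?thesis by (simp add: mult_ac)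
    qed
    have int: "w u integrable_on {0..?t}" "w v integrable_on {0..?t}"
      using wcont[OF u] wcont[OF v] by (auto intro: integrable_continuous_real)
    have "norm (I u ?t - I v ?t) = norm (integral {0..?t} (\<lambda>s. w u s - w v s))"
      unfolding I_def using int by (simp add: Henstock_Kurzweil_Integration.integral_diff)
    also have "\<dots> \<le> integral {0..?t} ?k"
      by (rule Henstock_Kurzweil_Integration.integral_norm_bound_integral)
        (use int ftc le in \<open>auto intro: integrable_diff\<close>)
    also have "\<dots> \<le> D * exp (2 * K * ?t) / 2" using integral_unique[OF ftc] D0 by simp
    finally have I: "norm (I u ?t - I v ?t) \<le> D * exp (2 * K * ?t) / 2" .
    have "norm (\<Phi> u t - \<Phi> v t) = exp (- 2 * K * ?t) * norm (I u ?t - I v ?t)"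
      by (simp add: \<Phi>_def flip: scaleR_diff_right)
    also have "\<dots> \<le> exp (- 2 * K * ?t) * (D * exp (2 * K * ?t) / 2)"
      using I by (intro mult_left_mono) auto
    also have "\<dots> = D / 2" by (simp add: exp_minus field_simps)
    finally show ?thesis .
  qed
  have \<Phi>0: "norm (\<Phi> (\<lambda>_. 0) t) \<le> norm (F p) / (2 * K)" for t
  proof -
    let ?t = "max 0 t"
    have "w (\<lambda>_. 0) = (\<lambda>_. F p)" by (simp add: w_def fun_eq_iff)
    then have "norm (\<Phi> (\<lambda>_. 0) t) = exp (- 2 * K * ?t) * (?t * norm (F p))"
      by (simp add: \<Phi>_def I_def)
    also have "\<dots> \<le> exp (- 2 * K * ?t) * (exp (2 * K * ?t) / (2 * K) * norm (F p))"
    proof (intro mult_left_mono mult_right_mono)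
      have "2 * K * ?t \<le> exp (2 * K * ?t)" using exp_ge_add_one_self[of "2 * K * ?t"] by linarith
      then show "?t \<le> exp (2 * K * ?t) / (2 * K)"
        using K by (simp add: pos_le_divide_eq mult_ac del: max.bounded_iff)
    qed auto
    also have "\<dots> = norm (F p) / (2 * K)" by (simp add: exp_minus field_simps)
    finally show ?thesis .
  qed
  have \<Phi>b: "\<Phi> (apply_bcontfun u) \<in> bcontfun" for u :: "real \<Rightarrow>\<^sub>C 'a"
  proof (rule bcontfun_normI[OF \<Phi>cont])
    fix t
    have "norm (\<Phi> u t - \<Phi> (\<lambda>_. 0) t) \<le> norm u / 2"
      by (rule contr) (auto simp: norm_bounded)
    then show "norm (\<Phi> u t) \<le> norm u / 2 + norm (F p) / (2 * K)"
      using \<Phi>0[of t] norm_triangle_sub[of "\<Phi> u t" "\<Phi> (\<lambda>_. 0) t"] by linarith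
  qed simp
  define T where "T u = Bcontfun (\<Phi> (apply_bcontfun u))" for u :: "real \<Rightarrow>\<^sub>C 'a"
  have T: "apply_bcontfun (T u) = \<Phi> (apply_bcontfun u)" for u
    unfolding T_def by (rule Bcontfun_inverse[OF \<Phi>b])
  have "\<exists>!u. T u = u"
  proof (rule banach_fix_type[of "1/2"])
    show "\<forall>u v. dist (T u) (T v) \<le> 1/2 * dist u v"
    proof (intro allI dist_bound)
      fix u v :: "real \<Rightarrow>\<^sub>C 'a" and t
      have "norm (\<Phi> u t - \<Phi> v t) \<le> dist u v / 2"
        by (rule contr) (auto simp: dist_bounded simp flip: dist_norm)
      then show "dist (T u t) (T v t) \<le> 1/2 * dist u v" by (simp add: T dist_norm)
    qed
  qed auto
  then obtain u where "T u = u" by blast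
  then have u: "\<Phi> u = apply_bcontfun u" using T by metis
  define c where "c t = p + I u t" for t
  have ct: "c t = p + exp (2 * K * t) *\<^sub>R u t" if "0 \<le> t" for t
  proof -
    have "exp (2 * K * t) *\<^sub>R \<Phi> u t = I u t" using that by (simp add: \<Phi>_def exp_minus)
    then show ?thesis by (simp add: u c_def)
  qed
  have "(c has_vector_derivative F (c t)) (at t within {0..})" if "0 \<le> t" for t
  proof -
    have "(c has_vector_derivative 0 + w u t) (at t within {0..})"
      unfolding c_def by (intro has_vector_derivative_add has_vector_derivative_const Ider that) simp
    then show ?thesis using ct[OF that] by (simp add: w_def)
  qed
  moreover have "c 0 = p" by (simp add: c_def I_def)
  ultimately show ?thesis using that by blast
qed

text \<open>Gronwall's inequality in a form that applies to distances, which are continuous but may have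
  corners. The factor \<open>exp (- K t)\<close> absorbs the linear term, because \<open>1 + K h \<le> exp (K h)\<close>.\<close>

lemma gronwall_zero:
  fixes d :: "real \<Rightarrow> real"
  assumes cont: "continuous_on {0..} d" and nonneg: "\<And>t. 0 \<le> d t" and zero: "d 0 = 0" and K: "0 \<le> K"
    and loc: "\<And>t e. 0 \<le> t \<Longrightarrow> 0 < e \<Longrightarrow>
       eventually (\<lambda>h. d (t + h) \<le> d t + K * h * d t + e * h) (at_right 0)"
    and "0 \<le> T"
  shows "d T = 0"
proof -
  let ?g = "\<lambda>t. exp (- K * t) * d t"
  have "?g T \<le> ?g 0 + e * (T - 0)" if e: "0 < e" for e
  proof (rule right_increments_bound)
    show "continuous_on {0..T} ?g"
      by (intro continuous_intros continuous_on_subset[OF cont]) auto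
    fix t :: real assume t: "0 \<le> t"
    show "eventually (\<lambda>h. ?g (t + h) \<le> ?g t + e * h) (at_right 0)"
      using loc[OF t e] eventually_at_right_less[of 0]
    proof eventually_elim
      case (elim h)
      have "?g (t + h) \<le> exp (- K * (t + h)) * ((1 + K * h) * d t + e * h)"
        using elim(1) by (intro mult_left_mono) (auto simp: algebra_simps)
      also have "\<dots> \<le> exp (- K * (t + h)) * (exp (K * h) * d t + e * h)"
        by (intro mult_left_mono add_right_mono mult_right_mono nonneg exp_ge_add_one_self) auto
      also have "\<dots> = ?g t + exp (- K * (t + h)) * (e * h)"
        by (simp add: algebra_simps flip: exp_add)
      also have "\<dots> \<le> ?g t + 1 * (e * h)"
        using elim(2) t K e by (intro add_left_mono mult_right_mono) auto
      finally show ?case by simp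
    qed
  qed fact
  then have bound: "?g T \<le> e * T" if "0 < e" for e using that zero by simp
  have "?g T \<le> 0 + e" if e: "0 < e" for e
  proof -
    have "?g T \<le> e / (T + 1) * T" using e \<open>0 \<le> T\<close> by (intro bound) simp
    also have "\<dots> \<le> e" using e \<open>0 \<le> T\<close> by (simp add: field_simps)
    finally show ?thesis by simp
  qed
  then have "?g T \<le> 0" by (rule field_le_epsilon)
  then show ?thesis using nonneg[of T] by (simp add: mult_le_0_iff)
qed

lemma has_vector_derivative_right_increment:
  assumes "(c has_vector_derivative v) (at t within {0..})" "0 \<le> t" "0 < e"
  shows "eventually (\<lambda>h. norm (c (t + h) - c t - h *\<^sub>R v) \<le> e * h) (at_right (0::real))"
proof -
  have "(c has_derivative (\<lambda>h. h *\<^sub>R v)) (at t within {0..})"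
    using assms(1) by (simp add: has_vector_derivative_def)
  then obtain d where d: "0 < d" "\<And>s. s \<in> {0..} \<Longrightarrow> norm (s - t) < d \<Longrightarrow>
      norm (c s - c t - (s - t) *\<^sub>R v) \<le> e * norm (s - t)"
    unfolding has_derivative_within_alt using assms(3) by blast
  have "norm (c (t + h) - c t - h *\<^sub>R v) \<le> e * h" if "0 < h" "h < d" for h
    using d(2)[of "t + h"] that assms(2) by simp
  then show ?thesis unfolding eventually_at_right_field using d(1) by blast
qed

text \<open>Nagumo's criterion. At each time, compare the solution with points of \<open>M\<close> that leave the point of
  \<open>M\<close> nearest to it in the direction of the field there. The two velocities differ by at most \<open>K\<close>
  times the distance, so the distance to \<open>M\<close> satisfies Gronwall's inequality.\<close>

lemma nagumo_invariance:
  fixes F :: "'a::euclidean_space \<Rightarrow> 'a"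
  assumes "closed M" "p \<in> M" and F: "K-lipschitz_on UNIV F"
    and tangent: "\<And>y. y \<in> M \<Longrightarrow> approach_vector M y (F y)"
    and c: "c 0 = p" "\<And>t. 0 \<le> t \<Longrightarrow> (c has_vector_derivative F (c t)) (at t within {0..})"
    and "0 \<le> T"
  shows "c T \<in> M"
proof -
  have K: "0 \<le> K" using F by (rule lipschitz_on_nonneg)
  have ne: "M \<noteq> {}" using assms(2) by blast
  have "infdist (c T) M = 0"
  proof (rule gronwall_zero[of "\<lambda>t. infdist (c t) M", OF _ _ _ K _ \<open>0 \<le> T\<close>])
    show "continuous_on {0..} (\<lambda>t. infdist (c t) M)"
      using c(2) by (intro continuous_on_infdist)
        (auto simp: continuous_on_eq_continuous_within intro: has_vector_derivative_continuous)
    show "infdist (c 0) M = 0" using c(1) assms(2) by simp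
    fix t e :: real assume t: "0 \<le> t" and e: "0 < e"
    obtain y where y: "y \<in> M" "infdist (c t) M = dist (c t) y"
      using infdist_attains_inf[OF assms(1) ne] by blast
    have "0 < e / 2" using e by simp
    from tangent[OF y(1)] this obtain d where d: "0 < d"
      "\<And>h. 0 < h \<and> h < d \<Longrightarrow> \<exists>x. x \<in> M \<and> norm (x - y - h *\<^sub>R F y) \<le> e / 2 * h"
      unfolding approach_vector_def by blast
    have "eventually (\<lambda>h. 0 < h \<and> h < d) (at_right 0)"
      using eventually_at_right_real[OF d(1)] by (auto elim: eventually_mono)
    with has_vector_derivative_right_increment[OF c(2)[OF t] t \<open>0 < e / 2\<close>]
    show "eventually (\<lambda>h. infdist (c (t + h)) M \<le> infdist (c t) M + K * h * infdist (c t) M + e * h) (at_right 0)"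
    proof eventually_elim
      case (elim h)
      then obtain x where x: "x \<in> M" "norm (x - y - h *\<^sub>R F y) \<le> e / 2 * h" using d(2) by blast
      have "c (t + h) - x = (c (t + h) - c t - h *\<^sub>R F (c t)) + ((c t - y) + h *\<^sub>R (F (c t) - F y)) - (x - y - h *\<^sub>R F y)"
        by (simp add: algebra_simps)
      then have "norm (c (t + h) - x) \<le> norm (c (t + h) - c t - h *\<^sub>R F (c t))
          + (norm (c t - y) + norm (h *\<^sub>R (F (c t) - F y))) + norm (x - y - h *\<^sub>R F y)"
        by (metis (no_types) norm_triangle_le_diff norm_triangle_ineq norm_triangle_mono order_refl
            add_mono)
      moreover have "norm (h *\<^sub>R (F (c t) - F y)) \<le> h * (K * norm (c t - y))"
        using lipschitz_on_normD[OF F, of "c t" y] elim(2) by simp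
      moreover have "infdist (c (t + h)) M \<le> dist (c (t + h)) x" by (rule infdist_le[OF x(1)])
      ultimately show ?case using elim(1) x(2) y(2) by (simp add: dist_norm mult_ac)
    qed
  qed (simp add: infdist_nonneg)
  then show ?thesis using in_closed_iff_infdist_zero[OF assms(1) ne] by blast
qed

lemma integral_curve_half_line_unique:
  assumes X: "K-lipschitz_on M X"
    and c: "\<And>t. c t \<in> M" "\<And>t. 0 \<le> t \<Longrightarrow> (c has_vector_derivative X (c t)) (at t within {0..})"
    and d: "\<And>t. d t \<in> M" "\<And>t. 0 \<le> t \<Longrightarrow> (d has_vector_derivative X (d t)) (at t within {0..})"
    and "c 0 = d 0" "0 \<le> T"
  shows "c T = d T"
proof -
  have K: "0 \<le> K" using X by (rule lipschitz_on_nonneg)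
  have "dist (c T) (d T) = 0"
  proof (rule gronwall_zero[of "\<lambda>t. dist (c t) (d t)", OF _ _ _ K _ \<open>0 \<le> T\<close>])
    show "continuous_on {0..} (\<lambda>t. dist (c t) (d t))"
      using c(2) d(2) by (intro continuous_on_dist)
        (auto simp: continuous_on_eq_continuous_within intro: has_vector_derivative_continuous)
    fix t e :: real assume t: "0 \<le> t" and e: "0 < e"
    then have "0 < e / 2" by simp
    from has_vector_derivative_right_increment[OF c(2)[OF t] t this]
      has_vector_derivative_right_increment[OF d(2)[OF t] t this] eventually_at_right_less[of 0]
    show "eventually (\<lambda>h. dist (c (t + h)) (d (t + h)) \<le> dist (c t) (d t) + K * h * dist (c t) (d t) + e * h) (at_right 0)"
    proof eventually_elim
      case (elim h)
      have "c (t + h) - d (t + h) = (c (t + h) - c t - h *\<^sub>R X (c t)) + ((c t - d t) + h *\<^sub>R (X (c t) - X (d t)))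
          - (d (t + h) - d t - h *\<^sub>R X (d t))"
        by (simp add: algebra_simps)
      then have "norm (c (t + h) - d (t + h)) \<le> norm (c (t + h) - c t - h *\<^sub>R X (c t))
          + (norm (c t - d t) + norm (h *\<^sub>R (X (c t) - X (d t)))) + norm (d (t + h) - d t - h *\<^sub>R X (d t))"
        by (metis (no_types) norm_triangle_le_diff norm_triangle_ineq norm_triangle_mono order_refl
            add_mono)
      moreover have "norm (h *\<^sub>R (X (c t) - X (d t))) \<le> h * (K * norm (c t - d t))"
        using lipschitz_on_normD[OF X c(1) d(1), of t t] elim(3) by simp
      ultimately show ?case using elim(1,2) by (simp add: dist_norm mult_ac)
    qed
  qed (use assms(6) in simp_all)
  then show ?thesis by simp
qed

lemma integral_curve_reverse:
  assumes "integral_curve M X c"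
  shows "integral_curve M (\<lambda>x. - X x) (\<lambda>t. c (- t))"
  unfolding integral_curve_def
proof (intro allI conjI)
  fix t
  show "c (- t) \<in> M" using assms by (simp add: integral_curve_def)
  have "(c has_vector_derivative X (c (- t))) (at (- t))" using assms by (simp add: integral_curve_def)
  then have "((c \<circ> uminus) has_vector_derivative (-1) *\<^sub>R X (c (- t))) (at t)"
    by (intro vector_diff_chain_at) (auto intro!: derivative_eq_intros)
  then show "((\<lambda>t. c (- t)) has_vector_derivative - X (c (- t))) (at t)" by (simp add: o_def)
qed

lemma integral_curve_unique:
  assumes X: "K-lipschitz_on M X" and "integral_curve M X c" "integral_curve M X d" "c 0 = d 0"
  shows "c = d"
proof
  fix t :: real
  have right: "c t = d t"
    if "K-lipschitz_on M X" "integral_curve M X c" "integral_curve M X d" "c 0 = d 0" "0 \<le> t" for t X c d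
    by (rule integral_curve_half_line_unique[OF that(1)])
      (use that in \<open>auto simp: integral_curve_def intro: has_vector_derivative_at_within\<close>)
  show "c t = d t"
  proof (cases "0 \<le> t")
    case True then show ?thesis using right assms by blast
  next
    case False
    have "K-lipschitz_on M (\<lambda>x. - X x)" using X by simp
    from right[OF this integral_curve_reverse[OF assms(2)] integral_curve_reverse[OF assms(3)], of "- t"]
    show ?thesis using False assms(4) by simp
  qed
qed

text \<open>Both halves of the curve are forward solutions, of the extended field and of its negative.\<close>

lemma integral_curve_exists:
  fixes X :: "'a::euclidean_space \<Rightarrow> 'a"
  assumes "closed M" "p \<in> M" and X: "K-lipschitz_on M X" and tangent: "\<And>y. y \<in> M \<Longrightarrow> X y \<in> tangent_space M y"
  obtains c where "integral_curve M X c" "c 0 = p"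
proof -
  have ne: "M \<noteq> {}" using assms(2) by blast
  obtain F K' where F: "K'-lipschitz_on UNIV F" "0 < K'" "\<And>x. x \<in> M \<Longrightarrow> F x = X x"
    by (rule lipschitz_extension[OF X ne]) blast
  obtain c where c: "c 0 = p" "\<And>t. 0 \<le> t \<Longrightarrow> (c has_vector_derivative F (c t)) (at t within {0..})"
    by (rule picard_half_line[OF F(1,2)]) blast
  have nF: "K'-lipschitz_on UNIV (\<lambda>x. - F x)" using F(1) by simp
  obtain b where b: "b 0 = p" "\<And>t. 0 \<le> t \<Longrightarrow> (b has_vector_derivative - F (b t)) (at t within {0..})"
    by (rule picard_half_line[OF nF F(2)]) blast
  have cM: "c t \<in> M" if "0 \<le> t" for t
    by (rule nagumo_invariance[OF assms(1,2) F(1) _ c that])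
      (use tangent F(3) in \<open>auto intro: tangent_space_approach\<close>)
  have bM: "b t \<in> M" if "0 \<le> t" for t
    by (rule nagumo_invariance[OF assms(1,2) nF _ b that])
      (use tangent F(3) in \<open>auto intro: tangent_space_approach\<close>)
  define \<gamma> where "\<gamma> t = (if t \<in> {..0} then b (- t) else c t)" for t
  have b': "((\<lambda>t. b (- t)) has_vector_derivative F (b (- t))) (at t within {..0})" if "t \<le> 0" for t
  proof -
    have "((b \<circ> uminus) has_vector_derivative (-1) *\<^sub>R (- F (b (- t)))) (at t within {..0})"
    proof (rule vector_diff_chain_within)
      show "(uminus has_vector_derivative -1) (at t within {..0})" by (auto intro!: derivative_eq_intros)
      have "uminus ` {..0::real} = {0..}" by (force simp: image_iff)
      then show "(b has_vector_derivative - F (b (- t))) (at (- t) within uminus ` {..0})"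
        using b(2)[of "- t"] that by simp
    qed
    then show ?thesis by (simp add: o_def)
  qed
  have "integral_curve M X \<gamma>"
    unfolding integral_curve_def
  proof (intro allI conjI)
    fix t
    show M: "\<gamma> t \<in> M" using bM cM by (simp add: \<gamma>_def)
    have "(\<gamma> has_vector_derivative (if t \<in> {..0} then F (b (- t)) else F (c t))) (at t within UNIV)"
      unfolding \<gamma>_def
      by (rule has_vector_derivative_If_within_closures[of t "{..0}" "{0..}" UNIV])
        (use b'[of t] c(2)[of t] b(1) c(1) in \<open>auto simp: insert_absorb Un_absorb2\<close>)
    then show "(\<gamma> has_vector_derivative X (\<gamma> t)) (at t)"
      using F(3)[OF M] by (auto simp: \<gamma>_def split: if_splits)
  qed
  moreover have "\<gamma> 0 = p" using b(1) by (simp add: \<gamma>_def)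
  ultimately show ?thesis using that by blast
qed

text \<open>Existence and uniqueness make \<open>flow M X\<close> a flow on \<open>M\<close>.\<close>

lemma flow_properties:
  fixes M :: "'a::euclidean_space set"
  assumes "compact M" "C1_vector_field M X"
  shows flow_integral_curve: "\<And>p. p \<in> M \<Longrightarrow> integral_curve M X (\<lambda>t. flow M X t p)"
    and flow_mem: "\<And>p t. p \<in> M \<Longrightarrow> flow M X t p \<in> M"
    and flow_0: "\<And>p. p \<in> M \<Longrightarrow> flow M X 0 p = p"
    and flow_add: "\<And>p s t. p \<in> M \<Longrightarrow> flow M X (s + t) p = flow M X s (flow M X t p)"
proof -
  obtain K where K: "K-lipschitz_on M X" by (rule C1_vector_field_lipschitz[OF assms])
  have tangent: "X y \<in> tangent_space M y" if "y \<in> M" for y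
    using assms(2) that by (simp add: C1_vector_field_def)
  have ex: "integral_curve M X (\<lambda>t. flow M X t p) \<and> flow M X 0 p = p" if p: "p \<in> M" for p
  proof -
    obtain c where c: "integral_curve M X c" "c 0 = p"
      by (rule integral_curve_exists[OF compact_imp_closed[OF assms(1)] p K tangent])
    have "(THE c. integral_curve M X c \<and> c 0 = p) = c"
      by (rule the_equality) (use c integral_curve_unique[OF K] in auto)
    then have "(\<lambda>t. flow M X t p) = c" by (simp add: flow_def fun_eq_iff)
    then show ?thesis using c by (metis (no_types))
  qed
  show curve: "integral_curve M X (\<lambda>t. flow M X t p)" if "p \<in> M" for p using ex[OF that] by blast
  show mem: "flow M X t p \<in> M" if "p \<in> M" for p t
    using curve[OF that] by (simp add: integral_curve_def)
  show zero: "flow M X 0 p = p" if "p \<in> M" for p using ex[OF that] by blast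
  show "flow M X (s + t) p = flow M X s (flow M X t p)" if p: "p \<in> M" for p s t
  proof -
    have "integral_curve M X (\<lambda>s. flow M X (s + t) p)"
      unfolding integral_curve_def
    proof (intro allI conjI)
      fix s
      have "((\<lambda>t. flow M X t p) has_vector_derivative X (flow M X (s + t) p)) (at (s + t))"
        using curve[OF p] by (simp add: integral_curve_def)
      then have "((\<lambda>t. flow M X t p) \<circ> (\<lambda>s. s + t) has_vector_derivative 1 *\<^sub>R X (flow M X (s + t) p)) (at s)"
        by (intro vector_diff_chain_at) (auto intro!: derivative_eq_intros)
      then show "((\<lambda>s. flow M X (s + t) p) has_vector_derivative X (flow M X (s + t) p)) (at s)"
        by (simp add: o_def)
    qed (use mem[OF p] in simp)
    from integral_curve_unique[OF K this curve[OF mem[OF p, of t]]] zero[OF mem[OF p, of t]]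
    have "(\<lambda>s. flow M X (s + t) p) = (\<lambda>s. flow M X s (flow M X t p))" by simp
    then show ?thesis by (rule fun_cong)
  qed
qed

section \<open>Closed orbits consist of split critical points\<close>

text \<open>In a chart that flattens \<open>M\<close> to a subspace \<open>S\<close>, the image of \<open>v\<close> is a limit of vectors in \<open>S\<close> and hence
in \<open>S\<close>. The line in its direction, pulled back to \<open>M\<close>, is a curve with velocity \<open>v\<close>.\<close>

lemma approach_vector_tangent:
  fixes M :: "'a::euclidean_space set"
  assumes "C1_submanifold M" "p \<in> M" "approach_vector M p v"
  shows "v \<in> tangent_space M p"
proof -
  obtain k where "\<forall>p\<in>M. \<exists>U V S. \<exists>(h :: 'a \<Rightarrow> 'a) g.
      open U \<and> p \<in> U \<and> open V \<and> homeomorphism U V h g \<and> C1_on h U \<and> C1_on g V \<and>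
      subspace S \<and> dim S = k \<and> h ` (M \<inter> U) = S \<inter> V"
    using assms(1) unfolding C1_submanifold_def by blast
  from bspec[OF this assms(2)] obtain U V S and h g :: "'a \<Rightarrow> 'a"
    where "open U \<and> p \<in> U \<and> open V \<and> homeomorphism U V h g \<and> C1_on h U \<and> C1_on g V \<and>
      subspace S \<and> dim S = k \<and> h ` (M \<inter> U) = S \<inter> V"
    by (elim exE)
  then have chart: "open U" "p \<in> U" "open V" "homeomorphism U V h g" "C1_on h U" "C1_on g V"
    "subspace S" "h ` (M \<inter> U) = S \<inter> V" by simp_all
  obtain h' where h': "\<And>x. x \<in> U \<Longrightarrow> (h has_derivative blinfun_apply (h' x)) (at x)"
    using chart(5) unfolding C1_on_def by blast
  obtain g' where g': "\<And>y. y \<in> V \<Longrightarrow> (g has_derivative blinfun_apply (g' y)) (at y)" "continuous_on V g'"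
    using chart(6) unfolding C1_on_def by blast
  have gh: "g (h x) = x" if "x \<in> U" for x using homeomorphism_apply1[OF chart(4) that] .
  have hM: "h x \<in> S" "h x \<in> V" if "x \<in> M" "x \<in> U" for x using chart(8) that by blast+
  have p: "h p \<in> S" "h p \<in> V" using hM assms(2) chart(2) by auto
  define w where "w = h' p v"
  have "w \<in> closure S"
    unfolding closure_approachable
  proof (intro allI impI)
    fix \<epsilon> :: real assume \<epsilon>: "0 < \<epsilon>"
    define N where "N = norm v + 1"
    have N: "0 < N" by (simp add: N_def add_nonneg_pos)
    define H where "H = norm (h' p) + 1"
    have H: "0 < H" by (simp add: H_def add_nonneg_pos)
    have "0 < \<epsilon> / (4 * N)" using \<epsilon> N by simp
    then obtain d1 where d1: "0 < d1" "\<And>y. norm (y - p) < d1 \<Longrightarrow>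
        norm (h y - h p - h' p (y - p)) \<le> \<epsilon> / (4 * N) * norm (y - p)"
      using h'[OF chart(2)] unfolding has_derivative_at_alt by blast
    obtain r where r: "0 < r" "ball p r \<subseteq> U" using chart(1,2) open_contains_ball by blast
    have "0 < min 1 (\<epsilon> / (4 * H))" using \<epsilon> H by simp
    then obtain d2 where d2: "0 < d2" "\<And>t. 0 < t \<and> t < d2 \<Longrightarrow>
        \<exists>x. x \<in> M \<and> norm (x - p - t *\<^sub>R v) \<le> min 1 (\<epsilon> / (4 * H)) * t"
      using assms(3) unfolding approach_vector_def by blast
    have "0 < min d2 (min (d1 / N) (r / N))" using d1 d2 r N by simp
    then obtain t where t: "0 < t" "t < min d2 (min (d1 / N) (r / N))" using dense by blast
    then have tN: "t * N < d1" "t * N < r" using N by (simp_all add: pos_less_divide_eq)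
    obtain x where x: "x \<in> M" "norm (x - p - t *\<^sub>R v) \<le> min 1 (\<epsilon> / (4 * H)) * t"
      using d2(2)[of t] t by auto
    have "min 1 (\<epsilon> / (4 * H)) * t \<le> 1 * t" "min 1 (\<epsilon> / (4 * H)) * t \<le> \<epsilon> / (4 * H) * t"
      using t(1) by (intro mult_right_mono; simp)+
    with x(2) have x1: "norm (x - p - t *\<^sub>R v) \<le> t" "norm (x - p - t *\<^sub>R v) \<le> \<epsilon> / (4 * H) * t"
      by linarith+
    have xp: "norm (x - p) \<le> t * N"
      using norm_triangle_sub[of "x - p" "t *\<^sub>R v"] x1(1) t(1) by (simp add: N_def algebra_simps)
    then have "x \<in> U" using tN(2) r(2) by (auto simp: dist_norm norm_minus_commute subset_iff)
    define s where "s = (h x - h p) /\<^sub>R t"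
    have "s \<in> S" unfolding s_def
      using hM(1)[OF x(1) \<open>x \<in> U\<close>] p(1) chart(7) by (intro subspace_scale subspace_diff)
    have "norm (h x - h p - h' p (x - p)) \<le> \<epsilon> / (4 * N) * norm (x - p)"
      using xp tN(1) by (intro d1(2)) simp
    also have "\<dots> \<le> \<epsilon> / (4 * N) * (t * N)" using xp \<epsilon> N by (intro mult_left_mono) auto
    finally have 1: "norm (h x - h p - h' p (x - p)) \<le> \<epsilon> / 4 * t" using N by simp
    have "norm (h' p (x - p - t *\<^sub>R v)) \<le> norm (h' p) * norm (x - p - t *\<^sub>R v)" by (rule norm_blinfun)
    also have "\<dots> \<le> H * (\<epsilon> / (4 * H) * t)" using x1(2) H by (intro mult_mono) (auto simp: H_def)
    finally have 2: "norm (h' p (x - p - t *\<^sub>R v)) \<le> \<epsilon> / 4 * t" using H by simp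
    have "t *\<^sub>R (s - w) = (h x - h p - h' p (x - p)) + h' p (x - p - t *\<^sub>R v)"
      using t(1) by (simp add: s_def w_def blinfun.bilinear_simps scaleR_diff_right)
    then have "norm (t *\<^sub>R (s - w)) \<le> \<epsilon> / 4 * t + \<epsilon> / 4 * t"
      using 1 2 norm_triangle_mono by metis
    then have "t * norm (s - w) \<le> t * (\<epsilon> / 2)" using t(1) by (simp add: mult.commute)
    then have "norm (s - w) \<le> \<epsilon> / 2" using t(1) by simp
    then show "\<exists>s\<in>S. dist s w < \<epsilon>" using \<open>s \<in> S\<close> \<epsilon> by (intro bexI[of _ s]) (auto simp: dist_norm)
  qed
  then have w: "w \<in> S" using closed_subspace[OF chart(7)] by (simp add: closure_closed)
  obtain r where r: "0 < r" "ball (h p) r \<subseteq> V" using chart(3) p(2) open_contains_ball by blast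
  define e where "e = r / (norm w + 1)"
  have e: "0 < e" using r(1) by (simp add: e_def add_nonneg_pos)
  have inV: "h p + t *\<^sub>R w \<in> V" if "t \<in> {-e<..<e}" for t
  proof -
    have "\<bar>t\<bar> * norm w \<le> \<bar>t\<bar> * (norm w + 1)" by (intro mult_left_mono) auto
    also have "\<dots> < r"
    proof -
      have "\<bar>t\<bar> < r / (norm w + 1)" using that by (auto simp: e_def abs_less_iff)
      moreover have "0 < norm w + 1" by (simp add: add_nonneg_pos)
      ultimately show ?thesis by (simp only: pos_less_divide_eq)
    qed
    finally have "h p + t *\<^sub>R w \<in> ball (h p) r" by (simp add: dist_norm)
    then show ?thesis using r(2) by blast
  qed
  define c where "c t = g (h p + t *\<^sub>R w)" for t
  have cM: "c t \<in> M" if "t \<in> {-e<..<e}" for t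
  proof -
    have "h p + t *\<^sub>R w \<in> S \<inter> V" using inV[OF that] p(1) w chart(7) by (simp add: subspace_add subspace_scale)
    then obtain x where "x \<in> M" "x \<in> U" "h p + t *\<^sub>R w = h x" using chart(8) by blast
    then show ?thesis using gh by (simp add: c_def)
  qed
  have der: "(c has_vector_derivative g' (h p + t *\<^sub>R w) w) (at t)" if "t \<in> {-e<..<e}" for t
  proof -
    have "((\<lambda>t. h p + t *\<^sub>R w) has_derivative (\<lambda>s. s *\<^sub>R w)) (at t)"
      by (auto intro!: derivative_eq_intros)
    from has_derivative_compose[OF this g'(1)[OF inV[OF that]]]
    show ?thesis unfolding c_def has_vector_derivative_def by (simp add: blinfun.bilinear_simps)
  qed
  have "continuous_on {-e<..<e} (\<lambda>t. g' (h p + t *\<^sub>R w) w)"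
    by (intro blinfun.continuous_on continuous_on_compose2[OF g'(2)] continuous_intros)
      (use inV in auto)
  then have "c C1_differentiable_on {-e<..<e}"
    unfolding C1_differentiable_on_def
    by (intro exI[of _ "\<lambda>t. g' (h p + t *\<^sub>R w) w"] conjI ballI der)
  moreover have "c 0 = p" using gh[OF chart(2)] by (simp add: c_def)
  moreover have "(c has_vector_derivative v) (at 0)"
  proof -
    have "((\<lambda>x. g (h x)) has_derivative (\<lambda>x. g' (h p) (h' p x))) (at p)"
      by (rule has_derivative_compose[OF h'[OF chart(2)] g'(1)[OF p(2)]])
    then have "((\<lambda>x. x) has_derivative (\<lambda>x. g' (h p) (h' p x))) (at p)"
      by (rule has_derivative_transform_within_open[OF _ chart(1,2) gh])
    then have "(\<lambda>x. g' (h p) (h' p x)) = (\<lambda>x. x)"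
      by (rule has_derivative_unique) (rule has_derivative_ident)
    then have "g' (h p) w = v" unfolding w_def by (rule fun_cong)
    then show ?thesis using der[of 0] e by simp
  qed
  ultimately show ?thesis
    unfolding tangent_space_def using e cM by (intro CollectI exI[of _ c] exI[of _ e]) auto
qed

lemma tangent_space_level_vector:
  assumes "v \<in> tangent_space N p" "N \<subseteq> M" "\<And>x. x \<in> N \<Longrightarrow> f x = f p"
  shows "level_vector M f p v" "level_vector M f p (- v)"
proof -
  have "level_vector M f p u" if "approach_vector N p u" for u
    unfolding level_vector_def
  proof (intro allI impI)
    fix e :: real assume e: "0 < e"
    then obtain d where d: "0 < d" "\<And>t. 0 < t \<and> t < d \<Longrightarrow> \<exists>x. x \<in> N \<and> norm (x - p - t *\<^sub>R u) \<le> e * t"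
      using \<open>approach_vector N p u\<close> unfolding approach_vector_def by blast
    show "\<exists>d. 0 < d \<and> (\<forall>t. 0 < t \<and> t < d \<longrightarrow>
        (\<exists>x. x \<in> M \<and> norm (x - p - t *\<^sub>R u) \<le> e * t \<and> norm (f x - f p) \<le> e * t))"
    proof (intro exI[of _ d] conjI allI impI)
      fix t assume t: "0 < t \<and> t < d"
      then obtain x where x: "x \<in> N" "norm (x - p - t *\<^sub>R u) \<le> e * t" using d(2) by blast
      moreover have "norm (f x - f p) \<le> e * t" using assms(3)[OF x(1)] t e by simp
      ultimately show "\<exists>x. x \<in> M \<and> norm (x - p - t *\<^sub>R u) \<le> e * t \<and> norm (f x - f p) \<le> e * t"
        using assms(2) by blast
    qed (fact d(1))
  qed
  then show "level_vector M f p v" "level_vector M f p (- v)"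
    using tangent_space_approach[OF assms(1)] by blast+
qed

text \<open>The Lipschitz condition carries the convergence of \<open>\<phi> t x\<close> to \<open>\<sigma>\<close> over to the values of \<open>f\<close>, which do not
depend on \<open>t\<close>.\<close>

lemma constant_on_stable_manifold:
  fixes M :: "'a::euclidean_space set" and f :: "'a \<Rightarrow> real"
  assumes f: "L-lipschitz_on M f"
    and inv: "\<And>t x. x \<in> M \<Longrightarrow> \<phi> t x \<in> M \<and> f (\<phi> t x) = f x"
    and \<sigma>: "\<sigma> \<subseteq> M" "\<sigma> \<noteq> {}" "\<And>z. z \<in> \<sigma> \<Longrightarrow> f z = s"
    and x: "x \<in> stable_manifold M \<phi> \<sigma>"
  shows "f x = s"
proof -
  have L: "0 \<le> L" using f by (rule lipschitz_on_nonneg)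
  have xM: "x \<in> M" and lim: "((\<lambda>t. infdist (\<phi> t x) \<sigma>) \<longlongrightarrow> 0) at_top"
    using x by (auto simp: stable_manifold_def)
  have le: "\<bar>f x - s\<bar> \<le> (L + 1) * infdist (\<phi> t x) \<sigma>" for t
  proof -
    have "\<bar>f x - s\<bar> / (L + 1) \<le> dist (\<phi> t x) z" if z: "z \<in> \<sigma>" for z
    proof -
      have "\<bar>f x - s\<bar> = dist (f (\<phi> t x)) (f z)" using inv[OF xM] \<sigma>(3)[OF z] by (simp add: dist_real_def)
      also have "\<dots> \<le> L * dist (\<phi> t x) z" using lipschitz_onD[OF f] inv[OF xM] z \<sigma>(1) by blast
      also have "\<dots> \<le> (L + 1) * dist (\<phi> t x) z" by (intro mult_right_mono) auto
      finally show ?thesis using L by (simp add: pos_divide_le_eq mult.commute)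
    qed
    then have "\<bar>f x - s\<bar> / (L + 1) \<le> infdist (\<phi> t x) \<sigma>"
      unfolding infdist_def using \<sigma>(2) by (auto intro: cINF_greatest)
    then show ?thesis using L by (simp add: pos_divide_le_eq mult.commute)
  qed
  have "((\<lambda>t. (L + 1) * infdist (\<phi> t x) \<sigma>) \<longlongrightarrow> (L + 1) * 0) at_top"
    by (intro tendsto_intros lim)
  then have "\<bar>f x - s\<bar> \<le> (L + 1) * 0"
    by (rule tendsto_lowerbound) (use le in auto)
  then show ?thesis by simp
qed

text \<open>A closed orbit lies in its own stable and in its own unstable manifold, so transversality of these two
splits every tangent vector at its points. The function \<open>f\<close> is constant on both manifolds.\<close>

lemma closed_orbit_split_critical:
  fixes M :: "'a::euclidean_space set"
  assumes M: "compact M" "C1_submanifold M" and X: "C1_vector_field M X"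
    and f: "L-lipschitz_on M f" and inv: "\<And>p t. p \<in> M \<Longrightarrow> f (flow M X t p) = f p"
    and \<gamma>: "\<gamma> \<in> closed_orbits M X" and trans: "transversal_manifolds M (flow M X) \<gamma> \<gamma>"
  shows "\<gamma> \<subseteq> split_critical M f"
proof
  fix y assume y: "y \<in> \<gamma>"
  obtain p where p: "p \<in> M" "\<gamma> = range (\<lambda>t. flow M X t p)" using \<gamma> unfolding closed_orbits_def by blast
  have sub: "\<gamma> \<subseteq> M" using p flow_mem[OF M(1) X] by auto
  have yM: "y \<in> M" using sub y by blast
  have fy: "f z = f y" if "z \<in> \<gamma>" for z using that y inv[OF p(1)] by (auto simp: p(2))
  have orbit: "flow M X t y \<in> \<gamma>" for t
  proof -
    obtain s where "y = flow M X s p" using y by (auto simp: p(2))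
    then have "flow M X t y = flow M X (t + s) p" using flow_add[OF M(1) X p(1)] by simp
    then show ?thesis by (simp add: p(2))
  qed
  \<comment> \<open>applied to the flow and to its reversal\<close>
  have level: "level_vector M f y v \<and> level_vector M f y (- v)"
    if inv': "\<And>t x. x \<in> M \<Longrightarrow> \<phi> t x \<in> M \<and> f (\<phi> t x) = f x" and v: "v \<in> stable_tangent M \<phi> \<gamma> y" for \<phi> v
  proof -
    obtain T where T: "v \<in> tangent_space (stable_piece M \<phi> \<gamma> UNIV T) y"
      using v unfolding stable_tangent_def by blast
    have const: "f x = f y" if "x \<in> stable_piece M \<phi> \<gamma> UNIV T" for x
    proof (rule constant_on_stable_manifold[OF f inv' sub _ fy])
      show "x \<in> stable_manifold M \<phi> \<gamma>" using that by (simp add: stable_piece_def)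
    qed (use y in auto)
    have "stable_piece M \<phi> \<gamma> UNIV T \<subseteq> M" by (auto simp: stable_piece_def stable_manifold_def)
    from tangent_space_level_vector[where f = f, OF T this] const show ?thesis by blast
  qed
  have "\<exists>a b. v = a - b \<and> level_vector M f y a \<and> level_vector M f y b" if v: "approach_vector M y v" for v
  proof -
    have "v \<in> tangent_space M y" by (rule approach_vector_tangent[OF M(2) yM v])
    moreover have "y \<in> stable_manifold M (flow M X) \<gamma> \<inter> unstable_manifold M (flow M X) \<gamma>"
      using yM orbit by (simp add: stable_manifold_def unstable_manifold_def)
    ultimately obtain a b where ab: "v = a + b" "a \<in> stable_tangent M (flow M X) \<gamma> y"
      "b \<in> stable_tangent M (\<lambda>t. flow M X (- t)) \<gamma> y"
      using trans unfolding transversal_manifolds_def unstable_tangent_def by blast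
    have "level_vector M f y a"
      using level[OF _ ab(2)] inv flow_mem[OF M(1) X] by blast
    moreover have "level_vector M f y (- b)"
      using level[OF _ ab(3)] inv flow_mem[OF M(1) X] by blast
    ultimately show ?thesis using ab(1) by (intro exI[of _ a] exI[of _ "- b"]) simp
  qed
  then show "y \<in> split_critical M f" using yM by (simp add: split_critical_def)
qed

section \<open>Values at nonwandering points\<close>

text \<open>A limit point of the sequence of positions at integral times is nonwandering, since the orbit
returns to each of its neighbourhoods after arbitrarily long times.\<close>

lemma nonwandering_value:
  fixes M :: "'a::euclidean_space set" and f :: "'a \<Rightarrow> real"
  assumes M: "compact M" and X: "C1_vector_field M X"
    and f: "continuous_on M f" and inv: "\<And>p t. p \<in> M \<Longrightarrow> f (flow M X t p) = f p" and p: "p \<in> M"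
  obtains q where "q \<in> nonwandering M X" "q \<in> M" "f q = f p"
proof -
  have mem: "flow M X t p \<in> M" for t by (rule flow_mem[OF M X p])
  obtain l r where l: "l \<in> M" "strict_mono (r :: nat \<Rightarrow> nat)"
    "((\<lambda>n. flow M X (real n) p) \<circ> r) \<longlonglongrightarrow> l"
    using M mem unfolding compact_def by metis
  have "(\<lambda>n. f (flow M X (real (r n)) p)) \<longlonglongrightarrow> f l"
    by (rule continuous_on_tendsto_compose[OF f _ l(1)]) (use l(3) mem in \<open>auto simp: o_def\<close>)
  then have "f l = f p" using inv[OF p] by (simp add: LIMSEQ_const_iff)
  moreover have "l \<in> nonwandering M X"
    unfolding nonwandering_def
  proof (intro CollectI conjI allI impI l(1))
    fix U T assume U: "openin (top_of_set M) U \<and> l \<in> U"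
    then obtain W where W: "open W" "U = M \<inter> W" by (auto simp: openin_open)
    then have "eventually (\<lambda>n. flow M X (real (r n)) p \<in> W) sequentially"
      using topological_tendstoD[OF l(3), of W] U by (simp add: o_def)
    then obtain N where N: "\<And>n. n \<ge> N \<Longrightarrow> flow M X (real (r n)) p \<in> U"
      using mem W(2) unfolding eventually_sequentially by blast
    obtain k where k: "real k > real (r N) + T" using reals_Archimedean2 by blast
    define n where "n = max N k"
    define t where "t = real (r n) - real (r N)"
    have "k \<le> r n" using seq_suble[OF l(2), of n] by (simp add: n_def)
    then have "t > T" using k by (simp add: t_def)
    moreover have "flow M X t (flow M X (real (r N)) p) = flow M X (real (r n)) p"
      using flow_add[OF M X p, of t "real (r N)"] by (simp add: t_def)
    then have "flow M X (real (r n)) p \<in> flow M X t ` U" using N[of N] by (metis imageI order_refl)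
    then have "U \<inter> flow M X t ` U \<noteq> {}" using N[of n] by (auto simp: n_def)
    ultimately show "\<exists>t>T. U \<inter> flow M X t ` U \<noteq> {}" by blast
  qed
  ultimately show ?thesis using that l(1) by blast
qed

section \<open>Absence of Lipschitz definable first integrals\<close>

text \<open>The two ways of listing coordinates differ by an invertible linear substitution.\<close>

lemma definable_fun_graph:
  fixes M :: "(real ^ 'n::{finite,linorder}) set"
  assumes "o_minimal_structure \<O>" "definable_fun \<O> M f"
  shows "o_minimal.definable \<O> (graph_on M f)"
proof -
  interpret o_minimal \<O> by unfold_locales (rule assms(1))
  let ?k = "Suc CARD('n)"
  let ?is = "sorted_list_of_set (UNIV :: 'n set)"
  let ?S = "(\<lambda>x. coordinates x @ [f x]) ` M"
  define coord where "coord j z = (coordinates (fst z) @ [snd z]) ! j" for j and z :: "(real, 'n) vec \<times> real"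
  have lin: "linear (coord j)" if j: "j < ?k" for j
  proof (cases "j < CARD('n)")
    case True
    then have "coord j = (\<lambda>z. fst z $ (?is ! j))" by (simp add: coord_def coordinates_def nth_append fun_eq_iff)
    then show ?thesis by (auto intro: linearI)
  next
    case False
    then have "coord j = snd" using j by (auto simp: coord_def coordinates_def nth_append fun_eq_iff)
    then show ?thesis by (auto intro: linearI)
  qed
  have inj: "x = y" if "coordinates x = coordinates y" for x y :: "(real, 'n) vec"
  proof -
    have "\<forall>i\<in>set ?is. x $ i = y $ i" using that by (simp add: coordinates_def)
    then show ?thesis by (simp add: vec_eq_iff)
  qed
  let ?m = "DIM((real, 'n) vec \<times> real)"
  let ?l = "\<lambda>zs. map (\<lambda>j. \<Sum>i<?m. coord j (basis_list ! i) * zs ! i) [0..<?k]"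
  have l: "?l zs = coordinates (fst z) @ [snd z]" if "z = vec_of zs" for zs and z :: "(real, 'n) vec \<times> real"
  proof (rule nth_equalityI)
    fix j assume "j < length (?l zs)"
    then have j: "j < ?k" by simp
    have "?l zs ! j = (\<Sum>i<?m. zs ! i *\<^sub>R coord j (basis_list ! i))"
      using j by (simp add: mult.commute del: upt_Suc DIM_prod)
    also have "\<dots> = coord j z" unfolding that by (rule linear_vec_of[OF lin[OF j], symmetric])
    finally show "?l zs ! j = (coordinates (fst z) @ [snd z]) ! j" by (simp add: coord_def)
  qed (simp add: coordinates_def)
  have "?S \<in> \<O> ?k" using assms(2) by (simp add: definable_fun_def)
  from linear_substitution[OF dim_ge[where 'a="(real, 'n) vec \<times> real"] _ this, of "\<lambda>j i. coord j (basis_list ! i)"]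
  have "{zs. length zs = ?m \<and> ?l zs \<in> ?S} \<in> \<O> ?m" by simp
  moreover have "?l zs \<in> ?S \<longleftrightarrow> vec_of zs \<in> graph_on M f" for zs
    unfolding l[OF refl]
    by (cases "vec_of zs :: (real, 'n) vec \<times> real") (auto dest: inj)
  ultimately show ?thesis by (simp add: definable_iff)
qed

theorem corollary2p5:
  fixes M :: "(real ^ 'n::{finite,linorder}) set"
    and X :: "real ^ 'n::{finite,linorder} \<Rightarrow> real ^ 'n::{finite,linorder}"
  assumes "compact M" and "connected M" and "M \<noteq> {}"
    and "C1_submanifold M"
    and "X \<in> generic_vector_fields M"
  shows "\<not> (\<exists>f :: real ^ 'n::{finite,linorder} \<Rightarrow> real.
            first_integral M X f \<and>
            (\<exists>L. L-lipschitz_on M f) \<and>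
            (\<exists>\<O>. o_minimal_structure \<O> \<and> definable_fun \<O> M f))"
proof
  assume "\<exists>f :: (real, 'n) vec \<Rightarrow> real. first_integral M X f \<and>
            (\<exists>L. L-lipschitz_on M f) \<and>
            (\<exists>\<O>. o_minimal_structure \<O> \<and> definable_fun \<O> M f)"
  then obtain f :: "(real, 'n) vec \<Rightarrow> real" and L \<O> where f: "first_integral M X f" "L-lipschitz_on M f"
    "o_minimal_structure \<O>" "definable_fun \<O> M f" by blast
  have cont: "continuous_on M f" and inv: "\<And>p t. p \<in> M \<Longrightarrow> f (flow M X t p) = f p"
    and nonconst: "\<And>U. openin (top_of_set M) U \<Longrightarrow> U \<noteq> {} \<Longrightarrow> \<not> f constant_on U"
    using f(1) by (auto simp: first_integral_def)
  have X: "C1_vector_field M X" and sing: "finite (singularities M X)"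
    and trans: "\<And>\<gamma>. \<gamma> \<in> critical_elements M X \<Longrightarrow> transversal_manifolds M (flow M X) \<gamma> \<gamma>"
    and nonw: "nonwandering M X = closure (\<Union>(critical_elements M X))"
    using assms(5) by (auto simp: generic_vector_fields_def)
  interpret o_minimal \<O> by unfold_locales (rule f(3))
  let ?V = "f ` singularities M X \<union> f ` split_critical M f"
  have V: "finite ?V"
    using finite_split_critical_values[OF definable_fun_graph[OF f(3,4)] compact_imp_bounded[OF assms(1)] f(2)] sing
    by simp
  have orbits: "\<gamma> \<subseteq> split_critical M f" if "\<gamma> \<in> closed_orbits M X" for \<gamma>
    by (rule closed_orbit_split_critical[OF assms(1,4) X f(2) inv that trans])
      (use that in \<open>auto simp: critical_elements_def\<close>)
  have crit: "f ` \<Union>(critical_elements M X) \<subseteq> ?V"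
    using orbits by (fastforce simp: critical_elements_def)
  have "\<Union>(critical_elements M X) \<subseteq> M"
    using orbits by (fastforce simp: critical_elements_def singularities_def split_critical_def)
  then have "closure (\<Union>(critical_elements M X)) \<subseteq> M"
    using compact_imp_closed[OF assms(1)] by (rule closure_minimal)
  then have "f ` closure (\<Union>(critical_elements M X)) \<subseteq> ?V"
    using image_closure_subset[OF continuous_on_subset[OF cont] finite_imp_closed[OF V] crit] by blast
  moreover have "f p \<in> f ` nonwandering M X" if p: "p \<in> M" for p
    using nonwandering_value[OF assms(1) X cont inv p] by (metis imageI)
  ultimately have "f ` M \<subseteq> ?V" unfolding nonw by blast
  then have "finite (f ` M)" using V finite_subset by blast
  moreover have "connected (f ` M)" by (rule connected_continuous_image[OF cont assms(2)])
  ultimately have "f ` M = {} \<or> (\<exists>s. f ` M = {s})" using connected_finite_iff_sing by blast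
  then have "f constant_on M" using assms(3) by (auto simp: constant_on_def)
  then show False using nonconst[of M] assms(3) by simp
qed

end
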